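(* Let $\mathcal{C}$ be a locally cartesian closed category equipped with a model structure in which: (i) $I$ is a good, but not necessarily very good, cylinder object for the terminal object; (ii) cofibrations are preserved by products (for every cofibration $i$ and object $D$, the map $D\times i$ is a cofibration); (iii) the pullback-powers of (trivial cofibration, fibration)-pairs and of (cofibration, trivial fibration)-pairs are trivial fibrations. Let $U\to V$ be a map between exponentiable objects, let $p_i\colon E_i\to B_i$ and $q_i\colon B_i'\to B_i$ be maps for $i=1,2$, and let $e\colon E_1\to E_2$, $b\colon B_1\to B_2$, $b'\colon B_1'\to B_2'$ satisfy $p_2e=bp_1$ and $q_2b'=bq_1$. For $i=1,2$ let $F_i$ be a lifting structure of $U\to V$ against $p_i$ right-restricted along $q_i$. Assume that $(U\to V,\ E_2\to B_2)$ is either a (trivial cofibration, fibration)-pair or a (cofibration, trivial fibration)-pair. Then there exists a structured $P^I_{B_2}(E_2)$-witness $H$ from $F_1$ to $F_2$ via $(e,b,b')$, where $P^I_{B_2}(E_2)=[B_2\times I,E_2]_{B_2}\to E_2\times_{B_2}E_2$ is the fibred $I$-path object with its boundary evaluation map.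
   Context: Good cylinder object: an object $I$ with a factorisation $1\sqcup 1\hookrightarrow I\xrightarrow{\sim}1$ of the codiagonal into a cofibration followed by a weak equivalence (very good: the second map is a trivial fibration). The pullback-power of a pair $(U\to V,E\to B)$ is the map $[V,E]\to[U,E]\times_{[U,B]}[V,B]$. $[-,-]$ denotes internal Hom in $\mathcal C$ and $[-,-]_{B}$ internal Hom in the slice $\mathcal C/B$. Fibred path object: $P^I_{B}(E)=[B\times I,E]_{B}\cong [I,E]\times_{[I,B]}B$, with boundary evaluation map $P^I_B(E)\to E\times_BE$ given by evaluation at the two points $1\sqcup1\to I$. Lifting structures: given $i\colon U\to V$, $p\colon E\to B$, $q\colon B'\to B$, a lifting structure $F$ of $i$ against $p$ right-restricted along $q$ is an assignment to every object $X$ and every pair $(u\colon X\times U\to E,\ v\colon X\times V\to B')$ with $pu=qv(X\times i)$ of a map $F_X(u,v)\colon X\times V\to E$ with $F_X(u,v)(X\times i)=u$ and $pF_X(u,v)=qv$, such that $F_Y(u(t\times U),v(t\times V))=F_X(u,v)(t\times V)$ for all $t\colon Y\to X$. By representability such $F$ is the same as a map $F\colon[U,E]\times_{[U,B]}[V,B']\to[V,E]$ over $[U,E]\times_{[U,B]}[V,B]$ (where $[V,B']\to[U,B]$ is induced by $i$ and $q$). Structured witness: given a fibrewise relation, i.e. a map $R_{B_2}(E_2)\to E_2\times_{B_2}E_2$, a structured $R_{B_2}(E_2)$-witness from $F_1$ to $F_2$ via $(e,b,b')$ is a map $H\colon[U,E_1]\times_{[U,B_1]}[V,B_1']\to[V,R_{B_2}(E_2)]$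 whose composite with $[V,R_{B_2}(E_2)]\to[V,E_2\times_{B_2}E_2]\cong[V,E_2]\times_{[V,B_2]}[V,E_2]$ is the pair $\bigl([V,e]\circ F_1,\ F_2\circ g\bigr)$, where $g\colon[U,E_1]\times_{[U,B_1]}[V,B_1']\to[U,E_2]\times_{[U,B_2]}[V,B_2']$ is the map induced by $(e,b,b')$. *)

theory Defs
  imports Main
begin

section \<open>Categories and universal constructions\<close>

record ('o, 'm) cat =
  Obj :: "'o set"
  Arr :: "'m set"
  Dom :: "'m \<Rightarrow> 'o"
  Cod :: "'m \<Rightarrow> 'o"
  Id :: "'o \<Rightarrow> 'm"
  Comp :: "'m \<Rightarrow> 'm \<Rightarrow> 'm"  (infixr "\<cdot>\<index>" 75)

definition hom :: "('o, 'm) cat \<Rightarrow> 'o \<Rightarrow> 'o \<Rightarrow> 'm set" where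
  "hom C X Y = {f \<in> Arr C. Dom C f = X \<and> Cod C f = Y}"

locale category =
  fixes C :: "('o, 'm) cat" (structure)
  assumes Dom_Obj: "f \<in> Arr C \<Longrightarrow> Dom C f \<in> Obj C"
    and Cod_Obj: "f \<in> Arr C \<Longrightarrow> Cod C f \<in> Obj C"
    and Id_hom: "X \<in> Obj C \<Longrightarrow> Id C X \<in> hom C X X"
    and Comp_hom: "f \<in> hom C X Y \<Longrightarrow> g \<in> hom C Y Z \<Longrightarrow> g \<cdot> f \<in> hom C X Z"
    and Comp_Id: "f \<in> hom C X Y \<Longrightarrow> f \<cdot> Id C X = f"
    and Id_Comp: "f \<in> hom C X Y \<Longrightarrow> Id C Y \<cdot> f = f"
    and Comp_assoc: "f \<in> hom C X Y \<Longrightarrow> g \<in> hom C Y Z \<Longrightarrow> h \<in> hom C Z T \<Longrightarrow>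
      (h \<cdot> g) \<cdot> f = h \<cdot> (g \<cdot> f)"

text \<open>
  Universal objects are introduced by predicates; where such an object exists, a fixed one is
  selected by Hilbert choice. The selected objects are meaningful only under the corresponding
  existence hypotheses.
\<close>

definition is_terminal :: "('o, 'm) cat \<Rightarrow> 'o \<Rightarrow> bool" where
  "is_terminal C T \<longleftrightarrow> T \<in> Obj C \<and> (\<forall>X \<in> Obj C. \<exists>!f. f \<in> hom C X T)"

definition one :: "('o, 'm) cat \<Rightarrow> 'o" where
  "one C = (SOME T. is_terminal C T)"

definition bang :: "('o, 'm) cat \<Rightarrow> 'o \<Rightarrow> 'm" where
  "bang C X = (THE f. f \<in> hom C X (one C))"

definition is_product :: "('o, 'm) cat \<Rightarrow> 'o \<Rightarrow> 'o \<Rightarrow> 'o \<times> 'm \<times> 'm \<Rightarrow> bool" where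
  "is_product C A B = (\<lambda>(P, p, q). P \<in> Obj C \<and> p \<in> hom C P A \<and> q \<in> hom C P B \<and>
     (\<forall>X \<in> Obj C. \<forall>f \<in> hom C X A. \<forall>g \<in> hom C X B.
        \<exists>!h. h \<in> hom C X P \<and> p \<cdot>\<^bsub>C\<^esub> h = f \<and> q \<cdot>\<^bsub>C\<^esub> h = g))"

definition prd :: "('o, 'm) cat \<Rightarrow> 'o \<Rightarrow> 'o \<Rightarrow> 'o" where
  "prd C A B = fst (SOME P. is_product C A B P)"

definition prd1 :: "('o, 'm) cat \<Rightarrow> 'o \<Rightarrow> 'o \<Rightarrow> 'm" where
  "prd1 C A B = fst (snd (SOME P. is_product C A B P))"

definition prd2 :: "('o, 'm) cat \<Rightarrow> 'o \<Rightarrow> 'o \<Rightarrow> 'm" where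
  "prd2 C A B = snd (snd (SOME P. is_product C A B P))"

definition pair :: "('o, 'm) cat \<Rightarrow> 'm \<Rightarrow> 'm \<Rightarrow> 'm" where
  "pair C f g = (THE h. h \<in> hom C (Dom C f) (prd C (Cod C f) (Cod C g)) \<and>
     prd1 C (Cod C f) (Cod C g) \<cdot>\<^bsub>C\<^esub> h = f \<and> prd2 C (Cod C f) (Cod C g) \<cdot>\<^bsub>C\<^esub> h = g)"

definition prd_map :: "('o, 'm) cat \<Rightarrow> 'm \<Rightarrow> 'm \<Rightarrow> 'm" where
  "prd_map C f g = pair C (f \<cdot>\<^bsub>C\<^esub> prd1 C (Dom C f) (Dom C g)) (g \<cdot>\<^bsub>C\<^esub> prd2 C (Dom C f) (Dom C g))"

definition is_coproduct :: "('o, 'm) cat \<Rightarrow> 'o \<Rightarrow> 'o \<Rightarrow> 'o \<times> 'm \<times> 'm \<Rightarrow> bool" where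
  "is_coproduct C A B = (\<lambda>(S, i, j). S \<in> Obj C \<and> i \<in> hom C A S \<and> j \<in> hom C B S \<and>
     (\<forall>X \<in> Obj C. \<forall>f \<in> hom C A X. \<forall>g \<in> hom C B X.
        \<exists>!h. h \<in> hom C S X \<and> h \<cdot>\<^bsub>C\<^esub> i = f \<and> h \<cdot>\<^bsub>C\<^esub> j = g))"

definition coprd :: "('o, 'm) cat \<Rightarrow> 'o \<Rightarrow> 'o \<Rightarrow> 'o" where
  "coprd C A B = fst (SOME S. is_coproduct C A B S)"

definition inj1 :: "('o, 'm) cat \<Rightarrow> 'o \<Rightarrow> 'o \<Rightarrow> 'm" where
  "inj1 C A B = fst (snd (SOME S. is_coproduct C A B S))"

definition inj2 :: "('o, 'm) cat \<Rightarrow> 'o \<Rightarrow> 'o \<Rightarrow> 'm" where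
  "inj2 C A B = snd (snd (SOME S. is_coproduct C A B S))"

definition codiagonal :: "('o, 'm) cat \<Rightarrow> 'o \<Rightarrow> 'm" where
  "codiagonal C A = (THE h. h \<in> hom C (coprd C A A) A \<and>
     h \<cdot>\<^bsub>C\<^esub> inj1 C A A = Id C A \<and> h \<cdot>\<^bsub>C\<^esub> inj2 C A A = Id C A)"

definition is_pullback :: "('o, 'm) cat \<Rightarrow> 'm \<Rightarrow> 'm \<Rightarrow> 'o \<times> 'm \<times> 'm \<Rightarrow> bool" where
  "is_pullback C f g = (\<lambda>(P, p, q). P \<in> Obj C \<and> p \<in> hom C P (Dom C f) \<and> q \<in> hom C P (Dom C g) \<and>
     f \<cdot>\<^bsub>C\<^esub> p = g \<cdot>\<^bsub>C\<^esub> q \<and>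
     (\<forall>X \<in> Obj C. \<forall>x \<in> hom C X (Dom C f). \<forall>y \<in> hom C X (Dom C g).
        f \<cdot>\<^bsub>C\<^esub> x = g \<cdot>\<^bsub>C\<^esub> y \<longrightarrow> (\<exists>!h. h \<in> hom C X P \<and> p \<cdot>\<^bsub>C\<^esub> h = x \<and> q \<cdot>\<^bsub>C\<^esub> h = y)))"

definition pb :: "('o, 'm) cat \<Rightarrow> 'm \<Rightarrow> 'm \<Rightarrow> 'o" where
  "pb C f g = fst (SOME P. is_pullback C f g P)"

definition pb1 :: "('o, 'm) cat \<Rightarrow> 'm \<Rightarrow> 'm \<Rightarrow> 'm" where
  "pb1 C f g = fst (snd (SOME P. is_pullback C f g P))"

definition pb2 :: "('o, 'm) cat \<Rightarrow> 'm \<Rightarrow> 'm \<Rightarrow> 'm" where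
  "pb2 C f g = snd (snd (SOME P. is_pullback C f g P))"

definition pb_pair :: "('o, 'm) cat \<Rightarrow> 'm \<Rightarrow> 'm \<Rightarrow> 'm \<Rightarrow> 'm \<Rightarrow> 'm" where
  "pb_pair C f g x y = (THE h. h \<in> hom C (Dom C x) (pb C f g) \<and>
     pb1 C f g \<cdot>\<^bsub>C\<^esub> h = x \<and> pb2 C f g \<cdot>\<^bsub>C\<^esub> h = y)"


section \<open>Internal homs and local cartesian closure\<close>

definition is_exponential :: "('o, 'm) cat \<Rightarrow> 'o \<Rightarrow> 'o \<Rightarrow> 'o \<times> 'm \<Rightarrow> bool" where
  "is_exponential C A Y = (\<lambda>(H, e). H \<in> Obj C \<and> e \<in> hom C (prd C H A) Y \<and>
     (\<forall>X \<in> Obj C. \<forall>f \<in> hom C (prd C X A) Y.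
        \<exists>!g. g \<in> hom C X H \<and> e \<cdot>\<^bsub>C\<^esub> prd_map C g (Id C A) = f))"

definition exponentiable :: "('o, 'm) cat \<Rightarrow> 'o \<Rightarrow> bool" where
  "exponentiable C A \<longleftrightarrow> A \<in> Obj C \<and> (\<forall>Y \<in> Obj C. \<exists>H. is_exponential C A Y H)"

definition ihom :: "('o, 'm) cat \<Rightarrow> 'o \<Rightarrow> 'o \<Rightarrow> 'o" where
  "ihom C A Y = fst (SOME H. is_exponential C A Y H)"

definition ev :: "('o, 'm) cat \<Rightarrow> 'o \<Rightarrow> 'o \<Rightarrow> 'm" where
  "ev C A Y = snd (SOME H. is_exponential C A Y H)"

definition transpose :: "('o, 'm) cat \<Rightarrow> 'o \<Rightarrow> 'o \<Rightarrow> 'o \<Rightarrow> 'm \<Rightarrow> 'm" where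
  "transpose C X A Y f =
     (THE g. g \<in> hom C X (ihom C A Y) \<and> ev C A Y \<cdot>\<^bsub>C\<^esub> prd_map C g (Id C A) = f)"

text \<open>\<open>ihom_post C A y\<close> is $[A,y]$ and \<open>ihom_pre C a Y\<close> is $[a,Y]$.\<close>

definition ihom_post :: "('o, 'm) cat \<Rightarrow> 'o \<Rightarrow> 'm \<Rightarrow> 'm" where
  "ihom_post C A y = transpose C (ihom C A (Dom C y)) A (Cod C y) (y \<cdot>\<^bsub>C\<^esub> ev C A (Dom C y))"

definition ihom_pre :: "('o, 'm) cat \<Rightarrow> 'm \<Rightarrow> 'o \<Rightarrow> 'm" where
  "ihom_pre C a Y = transpose C (ihom C (Cod C a) Y) (Dom C a) Y
     (ev C (Cod C a) Y \<cdot>\<^bsub>C\<^esub> prd_map C (Id C (ihom C (Cod C a) Y)) a)"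

definition cartesian_closed :: "('o, 'm) cat \<Rightarrow> bool" where
  "cartesian_closed C \<longleftrightarrow> category C \<and> (\<exists>T. is_terminal C T) \<and>
     (\<forall>A \<in> Obj C. \<forall>B \<in> Obj C. \<exists>P. is_product C A B P) \<and> (\<forall>A \<in> Obj C. exponentiable C A)"

text \<open>
  Objects of the slice over \<open>B\<close> are arrows with codomain \<open>B\<close>; the triple \<open>(p, f, q)\<close> is the
  arrow \<open>f\<close> regarded as a map from \<open>p\<close> to \<open>q\<close>.
\<close>

definition slice :: "('o, 'm) cat \<Rightarrow> 'o \<Rightarrow> ('m, 'm \<times> 'm \<times> 'm) cat" where
  "slice C B = \<lparr>
     Obj = {p \<in> Arr C. Cod C p = B},
     Arr = {(p, f, q). p \<in> Arr C \<and> Cod C p = B \<and> q \<in> Arr C \<and> Cod C q = B \<and>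
       f \<in> hom C (Dom C p) (Dom C q) \<and> q \<cdot>\<^bsub>C\<^esub> f = p},
     Dom = (\<lambda>(p, f, q). p),
     Cod = (\<lambda>(p, f, q). q),
     Id = (\<lambda>p. (p, Id C (Dom C p), p)),
     Comp = (\<lambda>(q, g, r) (p, f, q'). (p, g \<cdot>\<^bsub>C\<^esub> f, r)) \<rparr>"

definition underlying :: "'m \<times> 'm \<times> 'm \<Rightarrow> 'm" where
  "underlying = (\<lambda>(p, f, q). f)"

definition locally_cartesian_closed :: "('o, 'm) cat \<Rightarrow> bool" where
  "locally_cartesian_closed C \<longleftrightarrow> category C \<and> (\<exists>T. is_terminal C T) \<and>
     (\<forall>f \<in> Arr C. \<forall>g \<in> Arr C. Cod C f = Cod C g \<longrightarrow> (\<exists>P. is_pullback C f g P)) \<and>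
     (\<forall>B \<in> Obj C. cartesian_closed (slice C B))"


section \<open>Model structures\<close>

definition lifts_against :: "('o, 'm) cat \<Rightarrow> 'm \<Rightarrow> 'm \<Rightarrow> bool" where
  "lifts_against C i p \<longleftrightarrow>
     (\<forall>u \<in> hom C (Dom C i) (Dom C p). \<forall>v \<in> hom C (Cod C i) (Cod C p).
        p \<cdot>\<^bsub>C\<^esub> u = v \<cdot>\<^bsub>C\<^esub> i \<longrightarrow>
        (\<exists>d \<in> hom C (Cod C i) (Dom C p). d \<cdot>\<^bsub>C\<^esub> i = u \<and> p \<cdot>\<^bsub>C\<^esub> d = v))"

definition weak_factorisation_system :: "('o, 'm) cat \<Rightarrow> 'm set \<Rightarrow> 'm set \<Rightarrow> bool" where
  "weak_factorisation_system C L R \<longleftrightarrow>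
     L = {i \<in> Arr C. \<forall>p \<in> R. lifts_against C i p} \<and>
     R = {p \<in> Arr C. \<forall>i \<in> L. lifts_against C i p} \<and>
     (\<forall>f \<in> Arr C. \<exists>i \<in> L. \<exists>p \<in> R. Cod C i = Dom C p \<and> f = p \<cdot>\<^bsub>C\<^esub> i)"

definition two_out_of_three :: "('o, 'm) cat \<Rightarrow> 'm set \<Rightarrow> bool" where
  "two_out_of_three C W \<longleftrightarrow>
     (\<forall>f \<in> Arr C. \<forall>g \<in> Arr C. Cod C f = Dom C g \<longrightarrow>
        (f \<in> W \<and> g \<in> W \<longrightarrow> g \<cdot>\<^bsub>C\<^esub> f \<in> W) \<and>
        (f \<in> W \<and> g \<cdot>\<^bsub>C\<^esub> f \<in> W \<longrightarrow> g \<in> W) \<and>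
        (g \<in> W \<and> g \<cdot>\<^bsub>C\<^esub> f \<in> W \<longrightarrow> f \<in> W))"

text \<open>
  Closure of weak equivalences under retracts is not an axiom: it follows when pullbacks exist.
  Colimits are not required.
\<close>

definition model_structure :: "('o, 'm) cat \<Rightarrow> 'm set \<Rightarrow> 'm set \<Rightarrow> 'm set \<Rightarrow> bool" where
  "model_structure C Weq Cof Fib \<longleftrightarrow> Weq \<subseteq> Arr C \<and> two_out_of_three C Weq \<and>
     weak_factorisation_system C (Cof \<inter> Weq) Fib \<and>
     weak_factorisation_system C Cof (Fib \<inter> Weq)"

definition good_cylinder ::
  "('o, 'm) cat \<Rightarrow> 'm set \<Rightarrow> 'm set \<Rightarrow> 'o \<Rightarrow> 'o \<Rightarrow> 'm \<Rightarrow> 'm \<Rightarrow> bool" where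
  "good_cylinder C Weq Cof X I j s \<longleftrightarrow> (\<exists>S. is_coproduct C X X S) \<and>
     j \<in> hom C (coprd C X X) I \<and> s \<in> hom C I X \<and> s \<cdot>\<^bsub>C\<^esub> j = codiagonal C X \<and>
     j \<in> Cof \<and> s \<in> Weq"

text \<open>For \<open>i : U \<rightarrow> V\<close> and \<open>p : E \<rightarrow> B\<close>, the map $[V,E] \to [U,E] \times_{[U,B]} [V,B]$.\<close>

definition pullback_power :: "('o, 'm) cat \<Rightarrow> 'm \<Rightarrow> 'm \<Rightarrow> 'm" where
  "pullback_power C i p =
     pb_pair C (ihom_post C (Dom C i) p) (ihom_pre C i (Cod C p))
       (ihom_pre C i (Dom C p)) (ihom_post C (Cod C i) p)"


section \<open>Lifting structures\<close>

definition lifting_structure ::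
  "('o, 'm) cat \<Rightarrow> 'm \<Rightarrow> 'm \<Rightarrow> 'm \<Rightarrow> ('o \<Rightarrow> 'm \<Rightarrow> 'm \<Rightarrow> 'm) \<Rightarrow> bool" where
  "lifting_structure C i p q F \<longleftrightarrow>
     (let U = Dom C i; V = Cod C i; E = Dom C p; B' = Dom C q in
      \<forall>X \<in> Obj C. \<forall>u \<in> hom C (prd C X U) E. \<forall>v \<in> hom C (prd C X V) B'.
        p \<cdot>\<^bsub>C\<^esub> u = q \<cdot>\<^bsub>C\<^esub> v \<cdot>\<^bsub>C\<^esub> prd_map C (Id C X) i \<longrightarrow>
          F X u v \<in> hom C (prd C X V) E \<and>
          F X u v \<cdot>\<^bsub>C\<^esub> prd_map C (Id C X) i = u \<and>
          p \<cdot>\<^bsub>C\<^esub> F X u v = q \<cdot>\<^bsub>C\<^esub> v \<and>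
          (\<forall>Y \<in> Obj C. \<forall>t \<in> hom C Y X.
             F Y (u \<cdot>\<^bsub>C\<^esub> prd_map C t (Id C U)) (v \<cdot>\<^bsub>C\<^esub> prd_map C t (Id C V)) =
             F X u v \<cdot>\<^bsub>C\<^esub> prd_map C t (Id C V)))"

text \<open>
  The legs and the projections of $[U,E] \times_{[U,B]} [V,B']$, the object representing the
  lifting problems that a lifting structure solves.
\<close>

definition lift_leg1 :: "('o, 'm) cat \<Rightarrow> 'm \<Rightarrow> 'm \<Rightarrow> 'm" where
  "lift_leg1 C i p = ihom_post C (Dom C i) p"

definition lift_leg2 :: "('o, 'm) cat \<Rightarrow> 'm \<Rightarrow> 'm \<Rightarrow> 'm" where
  "lift_leg2 C i q = ihom_pre C i (Cod C q) \<cdot>\<^bsub>C\<^esub> ihom_post C (Cod C i) q"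

definition lift_dom :: "('o, 'm) cat \<Rightarrow> 'm \<Rightarrow> 'm \<Rightarrow> 'm \<Rightarrow> 'o" where
  "lift_dom C i p q = pb C (lift_leg1 C i p) (lift_leg2 C i q)"

definition lift_pr1 :: "('o, 'm) cat \<Rightarrow> 'm \<Rightarrow> 'm \<Rightarrow> 'm \<Rightarrow> 'm" where
  "lift_pr1 C i p q = pb1 C (lift_leg1 C i p) (lift_leg2 C i q)"

definition lift_pr2 :: "('o, 'm) cat \<Rightarrow> 'm \<Rightarrow> 'm \<Rightarrow> 'm \<Rightarrow> 'm" where
  "lift_pr2 C i p q = pb2 C (lift_leg1 C i p) (lift_leg2 C i q)"

text \<open>
  The map $[U,E] \times_{[U,B]} [V,B'] \to [V,E]$ corresponding to a lifting structure by
  representability: the transpose of its value at the universal lifting problem.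
\<close>

definition lift_map ::
  "('o, 'm) cat \<Rightarrow> 'm \<Rightarrow> 'm \<Rightarrow> 'm \<Rightarrow> ('o \<Rightarrow> 'm \<Rightarrow> 'm \<Rightarrow> 'm) \<Rightarrow> 'm" where
  "lift_map C i p q F =
     (let U = Dom C i; V = Cod C i; E = Dom C p; B' = Dom C q; P = lift_dom C i p q in
      transpose C P V E
        (F P (ev C U E \<cdot>\<^bsub>C\<^esub> prd_map C (lift_pr1 C i p q) (Id C U))
             (ev C V B' \<cdot>\<^bsub>C\<^esub> prd_map C (lift_pr2 C i p q) (Id C V))))"

text \<open>The map $[U,E_1] \times_{[U,B_1]} [V,B_1'] \to [U,E_2] \times_{[U,B_2]} [V,B_2']$ induced
  by \<open>e\<close> and \<open>b'\<close> (over the map induced by \<open>b\<close>).\<close>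

definition lift_dom_map ::
  "('o, 'm) cat \<Rightarrow> 'm \<Rightarrow> 'm \<Rightarrow> 'm \<Rightarrow> 'm \<Rightarrow> 'm \<Rightarrow> 'm \<Rightarrow> 'm \<Rightarrow> 'm" where
  "lift_dom_map C i p1 q1 p2 q2 e b' =
     pb_pair C (lift_leg1 C i p2) (lift_leg2 C i q2)
       (ihom_post C (Dom C i) e \<cdot>\<^bsub>C\<^esub> lift_pr1 C i p1 q1)
       (ihom_post C (Cod C i) b' \<cdot>\<^bsub>C\<^esub> lift_pr2 C i p1 q1)"

text \<open>
  The fibrewise relation is the arrow \<open>r\<close> from \<open>R\<close> to $E_2 \times_{B_2} E_2$. The outer \<open>pb_pair\<close>
  on the left is the comparison $[V,E_2 \times_{B_2} E_2] \cong [V,E_2] \times_{[V,B_2]} [V,E_2]$.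
  The base map \<open>b\<close> enters only through the commuting squares that make \<open>lift_dom_map\<close> well defined.
\<close>

definition structured_witness ::
  "('o, 'm) cat \<Rightarrow> 'm \<Rightarrow> 'm \<Rightarrow> 'm \<Rightarrow> 'm \<Rightarrow> 'm \<Rightarrow> 'm \<Rightarrow> 'm \<Rightarrow>
   ('o \<Rightarrow> 'm \<Rightarrow> 'm \<Rightarrow> 'm) \<Rightarrow> ('o \<Rightarrow> 'm \<Rightarrow> 'm \<Rightarrow> 'm) \<Rightarrow> 'o \<Rightarrow> 'm \<Rightarrow> 'm \<Rightarrow> bool" where
  "structured_witness C i p1 q1 p2 q2 e b' F1 F2 R r H \<longleftrightarrow>
     (let V = Cod C i; pV = ihom_post C V p2 in
      r \<in> hom C R (pb C p2 p2) \<and>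
      H \<in> hom C (lift_dom C i p1 q1) (ihom C V R) \<and>
      pb_pair C pV pV (ihom_post C V (pb1 C p2 p2)) (ihom_post C V (pb2 C p2 p2)) \<cdot>\<^bsub>C\<^esub>
        ihom_post C V r \<cdot>\<^bsub>C\<^esub> H =
      pb_pair C pV pV
        (ihom_post C V e \<cdot>\<^bsub>C\<^esub> lift_map C i p1 q1 F1)
        (lift_map C i p2 q2 F2 \<cdot>\<^bsub>C\<^esub> lift_dom_map C i p1 q1 p2 q2 e b'))"


section \<open>Fibred path objects\<close>

text \<open>
  For \<open>p : E \<rightarrow> B\<close>, the structure map of $[B \times I, E]_B$, formed in the slice over \<open>B\<close>,
  where $B \times I$ is an object over \<open>B\<close> by the first projection.
\<close>

definition path_proj :: "('o, 'm) cat \<Rightarrow> 'o \<Rightarrow> 'm \<Rightarrow> 'm" where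
  "path_proj C I p = ihom (slice C (Cod C p)) (prd1 C (Cod C p) I) p"

definition path_object :: "('o, 'm) cat \<Rightarrow> 'o \<Rightarrow> 'm \<Rightarrow> 'o" where
  "path_object C I p = Dom C (path_proj C I p)"

text \<open>
  Evaluation $[B \times I, E]_B \to E$ at a point \<open>t : 1 \<rightarrow> I\<close>: the evaluation map of the slice
  applied to the identity and the constant element of $B \times I$ with value \<open>t\<close>.
\<close>

definition path_ev :: "('o, 'm) cat \<Rightarrow> 'o \<Rightarrow> 'm \<Rightarrow> 'm \<Rightarrow> 'm" where
  "path_ev C I p t =
     (let B = Cod C p; D = slice C B; A = prd1 C B I; h = path_proj C I p in
      underlying (ev D A p \<cdot>\<^bsub>D\<^esub>
        pair D (Id D h) (h, pair C h (t \<cdot>\<^bsub>C\<^esub> bang C (Dom C h)), A)))"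

definition path_boundary :: "('o, 'm) cat \<Rightarrow> 'o \<Rightarrow> 'm \<Rightarrow> 'm \<Rightarrow> 'm" where
  "path_boundary C I j p =
     pb_pair C p p
       (path_ev C I p (j \<cdot>\<^bsub>C\<^esub> inj1 C (one C) (one C)))
       (path_ev C I p (j \<cdot>\<^bsub>C\<^esub> inj2 C (one C) (one C)))"

end

theory Submission
  imports Defs
begin

text \<open>
  Let \<open>D\<close> be the object $[U,E_1] \times_{[U,B_1]} [V,B_1']$ of lifting problems on the left. The
  witness compares two maps \<open>m, n\<close> from \<open>D\<close> to $[V,E_2]$: solve with \<open>F1\<close> and then transport
  along \<open>e\<close>, or transport the problem and then solve with \<open>F2\<close>. Both solve the same transported
  problem, so they agree after composition with the pullback-power \<open>k\<close> of \<open>i\<close> and \<open>p2\<close>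
  (\<open>lift_map_props\<close>, \<open>lift_dom_map_props\<close>). In either case of the hypothesis on the
  pair, \<open>k\<close> is a trivial fibration.

  Because \<open>j : 1 + 1 \<rightarrow> I\<close> is a cofibration, so is \<open>D \<times> j\<close>. Products distribute over coproducts
  (\<open>prd_coproduct\<close>), hence \<open>m\<close> and \<open>n\<close> together are a map out of \<open>D \<times> (1 + 1)\<close>, and lifting
  \<open>D \<times> j\<close> against \<open>k\<close> extends this map to a homotopy \<open>D \<times> I \<rightarrow> [V,E\<^sub>2]\<close> from \<open>m\<close> to \<open>n\<close> that is
  constant over the codomain of \<open>k\<close> (\<open>fibrewise_homotopy\<close>).

  What remains is a matter of adjunctions. The homotopy is a map \<open>(D \<times> V) \<times> I \<rightarrow> E\<^sub>2\<close> whose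
  composite with \<open>p2\<close> does not depend on \<open>I\<close>. This is exactly a map over \<open>B\<^sub>2\<close> from \<open>D \<times> V\<close> to
  the fibred path object, by its universal property in the slice (\<open>path_transpose\<close>), and its
  transpose \<open>D \<rightarrow> [V, P\<^sup>I(E\<^sub>2)]\<close> is the witness (\<open>ihom_path_transpose\<close>).

  Maps into products and internal homs are computed with throughout by means of generalised
  elements: \<open>ev C A Y \<cdot> pair C f a\<close> is the function \<open>f\<close> applied to the argument \<open>a\<close>, both over
  a common domain. In this form the defining equations of \<open>transpose\<close>, \<open>ihom_post\<close> and
  \<open>ihom_pre\<close> are rewrite rules.
\<close>

section \<open>Arrows and products\<close>

text \<open>
  Membership in a hom-set is unfolded to conditions on domain and codomain, which the simplifier
  can compute for composites; unlike a hom-set membership they name no intermediate object.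
\<close>

lemma hom_iff [simp]: "f \<in> hom C X Y \<longleftrightarrow> f \<in> Arr C \<and> Dom C f = X \<and> Cod C f = Y"
  by (auto simp: hom_def)

context category
begin

declare Dom_Obj [simp] Cod_Obj [simp]

lemma Comp_types [simp]:
  assumes "f \<in> Arr C" "g \<in> Arr C" "Cod C f = Dom C g"
  shows "g \<cdot> f \<in> Arr C" "Dom C (g \<cdot> f) = Dom C f" "Cod C (g \<cdot> f) = Cod C g"
  using Comp_hom[of f "Dom C f" "Dom C g" g "Cod C g"] assms by auto

lemma Id_types [simp]:
  assumes "X \<in> Obj C"
  shows "Id C X \<in> Arr C" "Dom C (Id C X) = X" "Cod C (Id C X) = X"
  using Id_hom[OF assms] by auto

lemma Comp_Id_right [simp]: "f \<in> Arr C \<Longrightarrow> Dom C f = X \<Longrightarrow> f \<cdot> Id C X = f"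
  by (rule Comp_Id) auto

lemma Comp_Id_left [simp]: "f \<in> Arr C \<Longrightarrow> Cod C f = Y \<Longrightarrow> Id C Y \<cdot> f = f"
  by (rule Id_Comp) auto

lemma Comp_assoc_right [simp]:
  assumes "f \<in> Arr C" "g \<in> Arr C" "h \<in> Arr C" "Cod C f = Dom C g" "Cod C g = Dom C h"
  shows "(h \<cdot> g) \<cdot> f = h \<cdot> (g \<cdot> f)"
  by (rule Comp_assoc[of f "Dom C f" "Dom C g" g "Dom C h" h "Cod C h"]) (use assms in auto)

text \<open>
  The form in which a commuting square is applied inside composites that are associated to the
  right.
\<close>

lemma square_Comp:
  assumes "g \<cdot> f = g' \<cdot> f'"
    and "f \<in> Arr C" "g \<in> Arr C" "Cod C f = Dom C g"
    and "f' \<in> Arr C" "g' \<in> Arr C" "Cod C f' = Dom C g'"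
    and "x \<in> Arr C" "Cod C x = Dom C f" "Cod C x = Dom C f'"
  shows "g \<cdot> (f \<cdot> x) = g' \<cdot> (f' \<cdot> x)"
  using assms by (metis Comp_assoc_right)

end

locale product_category = category +
  assumes products: "A \<in> Obj C \<Longrightarrow> B \<in> Obj C \<Longrightarrow> \<exists>P. is_product C A B P"
begin

lemma prd_is_product:
  assumes "A \<in> Obj C" "B \<in> Obj C"
  shows "is_product C A B (prd C A B, prd1 C A B, prd2 C A B)"
  using someI_ex[OF products[OF assms]] by (simp add: prd_def prd1_def prd2_def)

lemma prd_types [simp]:
  assumes "A \<in> Obj C" "B \<in> Obj C"
  shows "prd C A B \<in> Obj C"
    "prd1 C A B \<in> Arr C" "Dom C (prd1 C A B) = prd C A B" "Cod C (prd1 C A B) = A"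
    "prd2 C A B \<in> Arr C" "Dom C (prd2 C A B) = prd C A B" "Cod C (prd2 C A B) = B"
  using prd_is_product[OF assms] by (auto simp: is_product_def)

lemma prd_ex1:
  assumes "f \<in> Arr C" "g \<in> Arr C" "Dom C f = Dom C g" "Cod C f = A" "Cod C g = B"
  shows "\<exists>!h. h \<in> hom C (Dom C g) (prd C A B) \<and> prd1 C A B \<cdot> h = f \<and> prd2 C A B \<cdot> h = g"
proof -
  have "A \<in> Obj C" "B \<in> Obj C" "Dom C g \<in> Obj C" using assms by auto
  then show ?thesis using prd_is_product[of A B] assms unfolding is_product_def by simp
qed

lemma prd_ext:
  assumes "A \<in> Obj C" "B \<in> Obj C" "h \<in> hom C X (prd C A B)" "k \<in> hom C X (prd C A B)"
    and "prd1 C A B \<cdot> h = prd1 C A B \<cdot> k" "prd2 C A B \<cdot> h = prd2 C A B \<cdot> k"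
  shows "h = k"
proof -
  have "\<exists>!l. l \<in> hom C X (prd C A B) \<and> prd1 C A B \<cdot> l = prd1 C A B \<cdot> k
      \<and> prd2 C A B \<cdot> l = prd2 C A B \<cdot> k"
    using prd_ex1[of "prd1 C A B \<cdot> k" "prd2 C A B \<cdot> k" A B] assms by simp
  then show ?thesis using assms by blast
qed

lemma pair_props:
  assumes "f \<in> Arr C" "g \<in> Arr C" "Dom C f = Dom C g" "Cod C f = A" "Cod C g = B"
  shows "pair C f g \<in> hom C (Dom C g) (prd C A B) \<and>
    prd1 C A B \<cdot> pair C f g = f \<and> prd2 C A B \<cdot> pair C f g = g"
  using theI'[OF prd_ex1[OF assms]] assms by (simp add: pair_def)

lemma pair_types [simp]:
  assumes "f \<in> Arr C" "g \<in> Arr C" "Dom C f = Dom C g"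
  shows "pair C f g \<in> Arr C" "Dom C (pair C f g) = Dom C g"
    "Cod C (pair C f g) = prd C (Cod C f) (Cod C g)"
  using pair_props[OF assms refl refl] by auto

lemma prd_pair [simp]:
  assumes "f \<in> Arr C" "g \<in> Arr C" "Dom C f = Dom C g" "Cod C f = A" "Cod C g = B"
  shows "prd1 C A B \<cdot> pair C f g = f" "prd2 C A B \<cdot> pair C f g = g"
  using pair_props[OF assms] by auto

lemma pair_Comp [simp]:
  assumes "f \<in> Arr C" "g \<in> Arr C" "Dom C f = Dom C g" "h \<in> Arr C" "Cod C h = Dom C g"
  shows "pair C f g \<cdot> h = pair C (f \<cdot> h) (g \<cdot> h)"
proof (rule prd_ext[of "Cod C f" "Cod C g" _ "Dom C h"])
  show "prd1 C (Cod C f) (Cod C g) \<cdot> (pair C f g \<cdot> h) =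
      prd1 C (Cod C f) (Cod C g) \<cdot> pair C (f \<cdot> h) (g \<cdot> h)"
    using assms by (subst Comp_assoc_right[symmetric]) auto
  show "prd2 C (Cod C f) (Cod C g) \<cdot> (pair C f g \<cdot> h) =
      prd2 C (Cod C f) (Cod C g) \<cdot> pair C (f \<cdot> h) (g \<cdot> h)"
    using assms by (subst Comp_assoc_right[symmetric]) auto
qed (use assms in auto)

lemma pair_prd [simp]:
  assumes "A \<in> Obj C" "B \<in> Obj C"
  shows "pair C (prd1 C A B) (prd2 C A B) = Id C (prd C A B)"
  by (rule prd_ext[of A B _ "prd C A B"]) (use assms in auto)

lemma pair_prd_Comp [simp]:
  assumes "A \<in> Obj C" "B \<in> Obj C" "h \<in> Arr C" "Cod C h = prd C A B"
  shows "pair C (prd1 C A B \<cdot> h) (prd2 C A B \<cdot> h) = h"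
  by (rule prd_ext[of A B _ "Dom C h"]) (use assms in auto)

section \<open>Internal homs\<close>

lemma ihom_is_exponential:
  assumes "exponentiable C A" "Y \<in> Obj C"
  shows "is_exponential C A Y (ihom C A Y, ev C A Y)"
  using someI_ex[of "is_exponential C A Y"] assms
  by (auto simp: exponentiable_def ihom_def ev_def)

lemma exponentiable_Obj [simp]: "exponentiable C A \<Longrightarrow> A \<in> Obj C"
  by (simp add: exponentiable_def)

lemma ihom_types [simp]:
  assumes "exponentiable C A" "Y \<in> Obj C"
  shows "ihom C A Y \<in> Obj C" "ev C A Y \<in> Arr C"
    "Dom C (ev C A Y) = prd C (ihom C A Y) A" "Cod C (ev C A Y) = Y"
  using ihom_is_exponential[OF assms] by (auto simp: is_exponential_def)

lemma ihom_ex1: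
  assumes "exponentiable C A" "f \<in> hom C (prd C X A) Y" "X \<in> Obj C"
  shows "\<exists>!g. g \<in> hom C X (ihom C A Y) \<and> ev C A Y \<cdot> prd_map C g (Id C A) = f"
proof -
  have "Y \<in> Obj C" using assms by auto
  then show ?thesis
    using ihom_is_exponential[OF assms(1)] assms(2,3) unfolding is_exponential_def by auto
qed

lemma ihom_ext:
  assumes "exponentiable C A" "Y \<in> Obj C" "f \<in> hom C X (ihom C A Y)" "g \<in> hom C X (ihom C A Y)"
    and "ev C A Y \<cdot> pair C (f \<cdot> prd1 C X A) (prd2 C X A) =
      ev C A Y \<cdot> pair C (g \<cdot> prd1 C X A) (prd2 C X A)"
  shows "f = g"
proof -
  have X: "X \<in> Obj C" using assms(3) by auto
  have "ev C A Y \<cdot> prd_map C f (Id C A) = ev C A Y \<cdot> prd_map C g (Id C A)"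
    using assms X by (simp add: prd_map_def)
  moreover have "\<exists>!h. h \<in> hom C X (ihom C A Y) \<and>
      ev C A Y \<cdot> prd_map C h (Id C A) = ev C A Y \<cdot> prd_map C g (Id C A)"
    by (rule ihom_ex1) (use assms X in \<open>simp_all add: prd_map_def\<close>)
  ultimately show ?thesis using assms(3,4) by blast
qed

lemma transpose_props:
  assumes "exponentiable C A" "X \<in> Obj C" "f \<in> Arr C" "Dom C f = prd C X A" "Cod C f = Y"
  shows "transpose C X A Y f \<in> hom C X (ihom C A Y)"
    "ev C A Y \<cdot> prd_map C (transpose C X A Y f) (Id C A) = f"
proof -
  have "\<exists>!g. g \<in> hom C X (ihom C A Y) \<and> ev C A Y \<cdot> prd_map C g (Id C A) = f"
    by (rule ihom_ex1) (use assms in simp_all)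
  from theI'[OF this] show "transpose C X A Y f \<in> hom C X (ihom C A Y)"
    "ev C A Y \<cdot> prd_map C (transpose C X A Y f) (Id C A) = f"
    unfolding transpose_def by blast+
qed

lemma transpose_types [simp]:
  assumes "exponentiable C A" "X \<in> Obj C" "f \<in> Arr C" "Dom C f = prd C X A" "Cod C f = Y"
  shows "transpose C X A Y f \<in> Arr C" "Dom C (transpose C X A Y f) = X"
    "Cod C (transpose C X A Y f) = ihom C A Y"
  using transpose_props(1)[OF assms] by auto

lemma ev_transpose [simp]:
  assumes "exponentiable C A" "X \<in> Obj C" "f \<in> Arr C" "Dom C f = prd C X A" "Cod C f = Y"
    and "x \<in> Arr C" "Cod C x = X" "a \<in> Arr C" "Cod C a = A" "Dom C x = Dom C a"
  shows "ev C A Y \<cdot> pair C (transpose C X A Y f \<cdot> x) a = f \<cdot> pair C x a"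
proof -
  have Y: "Y \<in> Obj C" using assms by auto
  have "f \<cdot> pair C x a = (ev C A Y \<cdot> prd_map C (transpose C X A Y f) (Id C A)) \<cdot> pair C x a"
    using transpose_props(2)[OF assms(1-5)] by simp
  also have "\<dots> = ev C A Y \<cdot> pair C (transpose C X A Y f \<cdot> x) a"
    using assms Y by (simp add: prd_map_def)
  finally show ?thesis ..
qed

lemma ihom_post_types [simp]:
  assumes "exponentiable C A" "y \<in> Arr C"
  shows "ihom_post C A y \<in> Arr C" "Dom C (ihom_post C A y) = ihom C A (Dom C y)"
    "Cod C (ihom_post C A y) = ihom C A (Cod C y)"
  using assms by (simp_all add: ihom_post_def)

lemma ev_ihom_post [simp]:
  assumes "exponentiable C A" "y \<in> Arr C" "Cod C y = Y'"
    and "x \<in> Arr C" "Cod C x = ihom C A (Dom C y)" "a \<in> Arr C" "Cod C a = A" "Dom C x = Dom C a"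
  shows "ev C A Y' \<cdot> pair C (ihom_post C A y \<cdot> x) a = y \<cdot> (ev C A (Dom C y) \<cdot> pair C x a)"
  using assms by (simp add: ihom_post_def)

lemma ihom_pre_types [simp]:
  assumes "exponentiable C (Dom C a)" "exponentiable C (Cod C a)" "a \<in> Arr C" "Y \<in> Obj C"
  shows "ihom_pre C a Y \<in> Arr C" "Dom C (ihom_pre C a Y) = ihom C (Cod C a) Y"
    "Cod C (ihom_pre C a Y) = ihom C (Dom C a) Y"
  using assms by (simp_all add: ihom_pre_def prd_map_def)

lemma ev_ihom_pre [simp]:
  assumes "exponentiable C A" "exponentiable C (Cod C a)" "a \<in> Arr C" "Dom C a = A" "Y \<in> Obj C"
    and "x \<in> Arr C" "Cod C x = ihom C (Cod C a) Y" "u \<in> Arr C" "Cod C u = A" "Dom C x = Dom C u"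
  shows "ev C A Y \<cdot> pair C (ihom_pre C a Y \<cdot> x) u = ev C (Cod C a) Y \<cdot> pair C x (a \<cdot> u)"
  using assms by (simp add: ihom_pre_def prd_map_def)

lemma ihom_post_Comp:
  assumes "exponentiable C A" "y \<in> Arr C" "z \<in> Arr C" "Cod C y = Dom C z"
  shows "ihom_post C A (z \<cdot> y) = ihom_post C A z \<cdot> ihom_post C A y"
  by (rule ihom_ext[of A "Cod C z" _ "ihom C A (Dom C y)"]) (use assms in simp_all)

text \<open>
  Bifunctoriality of the internal hom; it makes the legs of a pullback-power commute.
\<close>

lemma ihom_pre_post:
  assumes "exponentiable C (Dom C a)" "exponentiable C (Cod C a)" "a \<in> Arr C" "y \<in> Arr C"
  shows "ihom_pre C a (Cod C y) \<cdot> ihom_post C (Cod C a) y =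
    ihom_post C (Dom C a) y \<cdot> ihom_pre C a (Dom C y)"
  by (rule ihom_ext[of "Dom C a" "Cod C y" _ "ihom C (Cod C a) (Dom C y)"]) (use assms in simp_all)

end

section \<open>The terminal object and pullbacks\<close>

locale finitely_complete_category = category +
  assumes terminal: "\<exists>T. is_terminal C T"
    and pullbacks: "f \<in> Arr C \<Longrightarrow> g \<in> Arr C \<Longrightarrow> Cod C f = Cod C g \<Longrightarrow> \<exists>P. is_pullback C f g P"
begin

lemma one_is_terminal: "is_terminal C (one C)"
  unfolding one_def by (rule someI_ex[OF terminal])

lemma one_Obj [simp]: "one C \<in> Obj C"
  using one_is_terminal by (simp add: is_terminal_def)

lemma bang_types [simp]:
  assumes "X \<in> Obj C"
  shows "bang C X \<in> Arr C" "Dom C (bang C X) = X" "Cod C (bang C X) = one C"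
proof -
  have "\<exists>!f. f \<in> hom C X (one C)" using one_is_terminal assms by (simp add: is_terminal_def)
  from theI'[OF this] show "bang C X \<in> Arr C" "Dom C (bang C X) = X" "Cod C (bang C X) = one C"
    by (auto simp: bang_def)
qed

lemma to_one_unique:
  assumes "f \<in> Arr C" "g \<in> Arr C" "Dom C f = Dom C g" "Cod C f = one C" "Cod C g = one C"
  shows "f = g"
proof -
  have "\<exists>!f. f \<in> hom C (Dom C g) (one C)"
    using one_is_terminal assms by (simp add: is_terminal_def)
  then show ?thesis using assms by auto
qed

lemma bang_Comp [simp]:
  "f \<in> Arr C \<Longrightarrow> Cod C f = X \<Longrightarrow> bang C X \<cdot> f = bang C (Dom C f)"
  by (rule to_one_unique) auto

end

sublocale finitely_complete_category \<subseteq> product_category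
proof
  fix A B assume AB: "A \<in> Obj C" "B \<in> Obj C"
  obtain P p q where P: "is_pullback C (bang C A) (bang C B) (P, p, q)"
    using pullbacks[of "bang C A" "bang C B"] AB by auto
  have "is_product C A B (P, p, q)"
    using P AB by (auto simp: is_pullback_def is_product_def)
  then show "\<exists>P. is_product C A B P" ..
qed

context finitely_complete_category
begin

text \<open>
  The condition that a cone commutes over the terminal object is vacuous. This identification
  lets the exponentials of the slice over the terminal object serve as exponentials of the
  category itself.
\<close>

lemma product_is_pullback_over_one:
  assumes "A \<in> Obj C" "B \<in> Obj C" "is_product C A B (P, p, q)"
  shows "is_pullback C (bang C A) (bang C B) (P, p, q)"
  using assms by (auto simp: is_pullback_def is_product_def)

lemma pb_is_pullback:
  assumes "f \<in> Arr C" "g \<in> Arr C" "Cod C f = Cod C g"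
  shows "is_pullback C f g (pb C f g, pb1 C f g, pb2 C f g)"
  using someI_ex[OF pullbacks[OF assms]] by (simp add: pb_def pb1_def pb2_def)

lemma pb_types [simp]:
  assumes "f \<in> Arr C" "g \<in> Arr C" "Cod C f = Cod C g"
  shows "pb C f g \<in> Obj C"
    "pb1 C f g \<in> Arr C" "Dom C (pb1 C f g) = pb C f g" "Cod C (pb1 C f g) = Dom C f"
    "pb2 C f g \<in> Arr C" "Dom C (pb2 C f g) = pb C f g" "Cod C (pb2 C f g) = Dom C g"
  using pb_is_pullback[OF assms] by (auto simp: is_pullback_def)

lemma pb_square:
  assumes "f \<in> Arr C" "g \<in> Arr C" "Cod C f = Cod C g"
  shows "f \<cdot> pb1 C f g = g \<cdot> pb2 C f g"
  using pb_is_pullback[OF assms] by (auto simp: is_pullback_def)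

lemma pb_ex1:
  assumes "f \<in> Arr C" "g \<in> Arr C" "Cod C f = Cod C g"
    and "x \<in> hom C X (Dom C f)" "y \<in> hom C X (Dom C g)" "f \<cdot> x = g \<cdot> y"
  shows "\<exists>!h. h \<in> hom C X (pb C f g) \<and> pb1 C f g \<cdot> h = x \<and> pb2 C f g \<cdot> h = y"
proof -
  have "X \<in> Obj C" using assms by auto
  then show ?thesis
    using pb_is_pullback[OF assms(1-3)] assms(4-) unfolding is_pullback_def by auto
qed

lemma pb_pair_props:
  assumes "f \<in> Arr C" "g \<in> Arr C" "Cod C f = Cod C g" "f \<cdot> x = g \<cdot> y"
    and "x \<in> Arr C" "y \<in> Arr C" "Dom C x = Dom C y" "Cod C x = Dom C f" "Cod C y = Dom C g"
  shows "pb_pair C f g x y \<in> Arr C" "Dom C (pb_pair C f g x y) = Dom C y"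
    "Cod C (pb_pair C f g x y) = pb C f g"
    "pb1 C f g \<cdot> pb_pair C f g x y = x" "pb2 C f g \<cdot> pb_pair C f g x y = y"
proof -
  have "\<exists>!h. h \<in> hom C (Dom C x) (pb C f g) \<and> pb1 C f g \<cdot> h = x \<and> pb2 C f g \<cdot> h = y"
    by (rule pb_ex1) (use assms in simp_all)
  from theI'[OF this] show "pb_pair C f g x y \<in> Arr C" "Dom C (pb_pair C f g x y) = Dom C y"
    "Cod C (pb_pair C f g x y) = pb C f g"
    "pb1 C f g \<cdot> pb_pair C f g x y = x" "pb2 C f g \<cdot> pb_pair C f g x y = y"
    using assms by (simp_all add: pb_pair_def)
qed

lemma pb_pair_unique:
  assumes "f \<in> Arr C" "g \<in> Arr C" "Cod C f = Cod C g"
    and "h \<in> Arr C" "Cod C h = pb C f g"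
  shows "pb_pair C f g (pb1 C f g \<cdot> h) (pb2 C f g \<cdot> h) = h"
proof -
  have "f \<cdot> (pb1 C f g \<cdot> h) = g \<cdot> (pb2 C f g \<cdot> h)"
    by (rule square_Comp[OF pb_square]) (use assms in auto)
  then have "\<exists>!k. k \<in> hom C (Dom C h) (pb C f g) \<and>
      pb1 C f g \<cdot> k = pb1 C f g \<cdot> h \<and> pb2 C f g \<cdot> k = pb2 C f g \<cdot> h"
    by (intro pb_ex1) (use assms in auto)
  from the1_equality[OF this, of h] show ?thesis using assms by (simp add: pb_pair_def)
qed

lemma pb_pair_Comp:
  assumes "f \<in> Arr C" "g \<in> Arr C" "Cod C f = Cod C g" "f \<cdot> x = g \<cdot> y"
    and "x \<in> Arr C" "y \<in> Arr C" "Dom C x = Dom C y" "Cod C x = Dom C f" "Cod C y = Dom C g"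
    and "h \<in> Arr C" "Cod C h = Dom C y"
  shows "pb_pair C f g x y \<cdot> h = pb_pair C f g (x \<cdot> h) (y \<cdot> h)"
proof -
  note pp = pb_pair_props[OF assms(1-9)]
  have "pb1 C f g \<cdot> (pb_pair C f g x y \<cdot> h) = x \<cdot> h" "pb2 C f g \<cdot> (pb_pair C f g x y \<cdot> h) = y \<cdot> h"
    by (subst Comp_assoc_right[symmetric], use assms pp in simp_all)+
  then show ?thesis
    using pb_pair_unique[of f g "pb_pair C f g x y \<cdot> h"] assms pp by simp
qed

lemma pullback_ex1:
  assumes "is_pullback C f g (P, p, q)" "x \<in> Arr C" "y \<in> Arr C" "Dom C x = Dom C y"
    and "Cod C x = Dom C f" "Cod C y = Dom C g" "f \<cdot> x = g \<cdot> y"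
  shows "\<exists>!h. h \<in> hom C (Dom C y) P \<and> p \<cdot> h = x \<and> q \<cdot> h = y"
proof -
  have "Dom C y \<in> Obj C" using assms by auto
  then show ?thesis using assms unfolding is_pullback_def by simp
qed

lemma pullback_ext:
  assumes "is_pullback C f g (P, p, q)" "f \<in> Arr C" "g \<in> Arr C"
    and "h \<in> hom C X P" "k \<in> hom C X P" "p \<cdot> h = p \<cdot> k" "q \<cdot> h = q \<cdot> k"
  shows "h = k"
proof -
  have pq: "p \<in> hom C P (Dom C f)" "q \<in> hom C P (Dom C g)" "f \<cdot> p = g \<cdot> q"
    using assms(1) by (auto simp: is_pullback_def)
  have "f \<cdot> (p \<cdot> k) = g \<cdot> (q \<cdot> k)"
    by (rule square_Comp[OF pq(3)]) (use pq assms in auto)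
  then have "\<exists>!l. l \<in> hom C (Dom C (q \<cdot> k)) P \<and> p \<cdot> l = p \<cdot> k \<and> q \<cdot> l = q \<cdot> k"
    by (intro pullback_ex1[OF assms(1)]) (use pq assms in auto)
  moreover have "Dom C (q \<cdot> k) = X" using pq assms by simp
  ultimately show ?thesis using assms(4-) by blast
qed

text \<open>
  The slice object \<open>B \<times> I\<close> is the pullback of \<open>I\<close> along \<open>B \<rightarrow> 1\<close>, so its base change along
  \<open>w : W \<rightarrow> B\<close> is \<open>W \<times> I\<close>. This turns maps into a fibred path object into homotopies.
\<close>

lemma prd_base_change_is_pullback:
  assumes "w \<in> Arr C" "I \<in> Obj C"
  shows "is_pullback C w (prd1 C (Cod C w) I) (prd C (Dom C w) I, prd1 C (Dom C w) I,
    pair C (w \<cdot> prd1 C (Dom C w) I) (prd2 C (Dom C w) I))"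
  unfolding is_pullback_def prod.case
proof (intro conjI ballI impI)
  fix X x y
  assume X: "X \<in> Obj C" and x: "x \<in> hom C X (Dom C w)"
    and y: "y \<in> hom C X (Dom C (prd1 C (Cod C w) I))"
    and sq: "w \<cdot> x = prd1 C (Cod C w) I \<cdot> y"
  let ?h = "pair C x (prd2 C (Cod C w) I \<cdot> y)"
  let ?q = "pair C (w \<cdot> prd1 C (Dom C w) I) (prd2 C (Dom C w) I)"
  show "\<exists>!h. h \<in> hom C X (prd C (Dom C w) I) \<and> prd1 C (Dom C w) I \<cdot> h = x \<and> ?q \<cdot> h = y"
  proof (rule ex1I[of _ ?h])
    show "?h \<in> hom C X (prd C (Dom C w) I) \<and> prd1 C (Dom C w) I \<cdot> ?h = x \<and> ?q \<cdot> ?h = y"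
      using assms X x y by (simp add: sq)
  next
    fix h
    assume h: "h \<in> hom C X (prd C (Dom C w) I) \<and> prd1 C (Dom C w) I \<cdot> h = x \<and> ?q \<cdot> h = y"
    have "prd2 C (Cod C w) I \<cdot> (?q \<cdot> h) = prd2 C (Dom C w) I \<cdot> h"
      using assms x conjunct1[OF h] conjunct1[OF conjunct2[OF h]] by simp
    then have 2: "prd2 C (Dom C w) I \<cdot> h = prd2 C (Cod C w) I \<cdot> y" using h by metis
    show "h = ?h"
      by (rule prd_ext[of "Dom C w" I _ X]) (use 2 assms x y h in simp_all)
  qed
qed (use assms in simp_all)

end

section \<open>Exponentials in slices\<close>

lemma slice_simps [simp]:
  "Obj (slice C B) = {p \<in> Arr C. Cod C p = B}"
  "Dom (slice C B) (p, f, q) = p"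
  "Cod (slice C B) (p, f, q) = q"
  "Id (slice C B) p = (p, Id C (Dom C p), p)"
  "Comp (slice C B) (q', g, r) (p, f, q) = (p, Comp C g f, r)"
  by (simp_all add: slice_def)

lemma underlying_simp [simp]: "underlying (p, f, q) = f"
  by (simp add: underlying_def)

lemma slice_Arr_iff [simp]:
  "(p, f, q) \<in> Arr (slice C B) \<longleftrightarrow> p \<in> Arr C \<and> Cod C p = B \<and> q \<in> Arr C \<and> Cod C q = B \<and>
    f \<in> Arr C \<and> Dom C f = Dom C p \<and> Cod C f = Dom C q \<and> Comp C q f = p"
  by (auto simp: slice_def)

lemma slice_arrow_eq: "(Dom (slice C B) t, underlying t, Cod (slice C B) t) = t"
  by (cases t) simp

lemma underlying_Comp [simp]:
  "underlying (Comp (slice C B) t t') = Comp C (underlying t) (underlying t')"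
  by (cases t; cases t') simp

lemma underlying_types:
  assumes "t \<in> Arr (slice C B)"
  shows "underlying t \<in> Arr C" "Dom C (underlying t) = Dom C (Dom (slice C B) t)"
    "Cod C (underlying t) = Dom C (Cod (slice C B) t)"
    "Comp C (Cod (slice C B) t) (underlying t) = Dom (slice C B) t"
  using assms by (cases t, simp)+

locale lcc_category = finitely_complete_category +
  assumes slices: "B \<in> Obj C \<Longrightarrow> cartesian_closed (slice C B)"
begin

lemma slice_product_category: "B \<in> Obj C \<Longrightarrow> product_category (slice C B)"
  using slices unfolding cartesian_closed_def product_category_def product_category_axioms_def
  by blast

lemma slice_exponentiable: "a \<in> Arr C \<Longrightarrow> Cod C a = B \<Longrightarrow> exponentiable (slice C B) a"
  using slices[of B] Cod_Obj[of a] unfolding cartesian_closed_def by auto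

definition local_hom :: "'b \<Rightarrow> 'b \<Rightarrow> 'b" where
  "local_hom a p = ihom (slice C (Cod C p)) a p"

text \<open>
  Application of a generalised element \<open>u\<close> of the local internal hom \<open>h\<close> to a generalised
  element \<open>v\<close> of the domain of \<open>a\<close>, where \<open>h \<cdot> u = a \<cdot> v\<close> is their common image in the base.
  It is stated through arrows of the ambient category, so that its users never see a product
  selected in the slice.
\<close>

definition local_app :: "'b \<Rightarrow> 'b \<Rightarrow> 'b \<Rightarrow> 'b \<Rightarrow> 'b" where
  "local_app a p u v = (let D = slice C (Cod C p); h = local_hom a p in
     underlying (ev D a p \<cdot>\<^bsub>D\<^esub> pair D (h \<cdot> u, u, h) (h \<cdot> u, v, a)))"

lemma local_hom_types [simp]:
  assumes "a \<in> Arr C" "p \<in> Arr C" "Cod C a = Cod C p"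
  shows "local_hom a p \<in> Arr C" "Cod C (local_hom a p) = Cod C p"
proof -
  interpret S: product_category "slice C (Cod C p)"
    by (rule slice_product_category) (use assms in simp)
  show "local_hom a p \<in> Arr C" "Cod C (local_hom a p) = Cod C p"
    using S.ihom_types(1)[OF slice_exponentiable[OF assms(1,3)], of p] assms
    by (simp_all add: local_hom_def)
qed

lemma local_app_types [simp]:
  assumes "a \<in> Arr C" "p \<in> Arr C" "Cod C a = Cod C p"
    and "u \<in> Arr C" "v \<in> Arr C" "Dom C u = Dom C v"
    and "Cod C u = Dom C (local_hom a p)" "Cod C v = Dom C a" "local_hom a p \<cdot> u = a \<cdot> v"
  shows "local_app a p u v \<in> Arr C" "Dom C (local_app a p u v) = Dom C v"
    "Cod C (local_app a p u v) = Dom C p" "p \<cdot> local_app a p u v = a \<cdot> v"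
proof -
  let ?S = "slice C (Cod C p)"
  interpret S: product_category ?S
    by (rule slice_product_category) (use assms in simp)
  note ea = slice_exponentiable[OF assms(1,3)]
  let ?h = "local_hom a p"
  have h: "?h \<in> Arr C" "Cod C ?h = Cod C p" using assms by simp_all
  let ?u = "(a \<cdot> v, u, ?h)" and ?v = "(a \<cdot> v, v, a)"
  have uv: "?u \<in> Arr ?S" "?v \<in> Arr ?S" using assms h by auto
  let ?t = "ev ?S a p \<cdot>\<^bsub>?S\<^esub> pair ?S ?u ?v"
  have ev: "ev ?S a p \<in> Arr ?S" "Dom ?S (ev ?S a p) = prd ?S ?h a" "Cod ?S (ev ?S a p) = p"
    using S.ihom_types[OF ea, of p] assms by (simp_all add: local_hom_def)
  have P: "pair ?S ?u ?v \<in> Arr ?S" "Dom ?S (pair ?S ?u ?v) = a \<cdot> v"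
    "Cod ?S (pair ?S ?u ?v) = prd ?S ?h a"
    using S.pair_types[OF uv] by simp_all
  have t: "?t \<in> Arr ?S" "Dom ?S ?t = a \<cdot> v" "Cod ?S ?t = p"
    using S.Comp_types[OF P(1) ev(1)] ev P by simp_all
  have eq: "local_app a p u v = underlying ?t"
    using assms by (simp add: local_app_def Let_def)
  show "local_app a p u v \<in> Arr C" "Dom C (local_app a p u v) = Dom C v"
    "Cod C (local_app a p u v) = Dom C p" "p \<cdot> local_app a p u v = a \<cdot> v"
    unfolding eq using underlying_types[OF t(1)] t assms by (simp_all del: underlying_Comp)
qed

lemma local_app_Comp:
  assumes "a \<in> Arr C" "p \<in> Arr C" "Cod C a = Cod C p"
    and "u \<in> Arr C" "v \<in> Arr C" "Dom C u = Dom C v"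
    and "Cod C u = Dom C (local_hom a p)" "Cod C v = Dom C a" "local_hom a p \<cdot> u = a \<cdot> v"
    and "z \<in> Arr C" "Cod C z = Dom C v"
  shows "local_app a p u v \<cdot> z = local_app a p (u \<cdot> z) (v \<cdot> z)"
proof -
  let ?S = "slice C (Cod C p)"
  interpret S: product_category ?S
    by (rule slice_product_category) (use assms in simp)
  note ea = slice_exponentiable[OF assms(1,3)]
  let ?h = "local_hom a p"
  have h: "?h \<in> Arr C" "Cod C ?h = Cod C p" using assms by simp_all
  have sq: "?h \<cdot> (u \<cdot> z) = a \<cdot> (v \<cdot> z)"
    by (rule square_Comp[OF assms(9)]) (use assms h in simp_all)
  let ?u = "(a \<cdot> v, u, ?h)" and ?v = "(a \<cdot> v, v, a)" and ?z = "(a \<cdot> (v \<cdot> z), z, a \<cdot> v)"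
  have uvz: "?u \<in> Arr ?S" "?v \<in> Arr ?S" "?z \<in> Arr ?S" using assms h by auto
  have "pair ?S ?u ?v \<cdot>\<^bsub>?S\<^esub> ?z = pair ?S (a \<cdot> (v \<cdot> z), u \<cdot> z, ?h) (a \<cdot> (v \<cdot> z), v \<cdot> z, a)"
    using S.pair_Comp[OF uvz(1,2) _ uvz(3)] by simp
  then have "underlying (pair ?S ?u ?v) \<cdot> z =
      underlying (pair ?S (a \<cdot> (v \<cdot> z), u \<cdot> z, ?h) (a \<cdot> (v \<cdot> z), v \<cdot> z, a))"
    by (metis underlying_Comp underlying_simp)
  moreover have "underlying (pair ?S ?u ?v) \<in> Arr C"
    "Dom C (underlying (pair ?S ?u ?v)) = Dom C v"
    "Cod C (underlying (pair ?S ?u ?v)) = Dom C (prd ?S ?h a)"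
    using underlying_types[OF S.pair_types(1)[OF uvz(1,2)]] S.pair_types[OF uvz(1,2)] assms
    by simp_all
  moreover have "underlying (ev ?S a p) \<in> Arr C"
    "Dom C (underlying (ev ?S a p)) = Dom C (prd ?S ?h a)"
    using underlying_types[OF S.ihom_types(2)[OF ea, of p]] S.ihom_types[OF ea, of p] assms
    by (simp_all add: local_hom_def)
  ultimately show ?thesis
    using assms sq by (simp add: local_app_def Let_def)
qed

text \<open>
  The universal property of an exponential in the slice, freed from the product that was selected
  there: any pullback of \<open>x\<close> and \<open>a\<close> may serve as the product of \<open>x\<close> and \<open>a\<close> over the base.
  The reason is that products in a slice are pullbacks, so the two differ by an isomorphism,
  and application of elements is natural with respect to it.
\<close>

lemma local_exponential:
  assumes "a \<in> Arr C" "p \<in> Arr C" "Cod C a = Cod C p"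
    and "x \<in> Arr C" "Cod C x = Cod C p"
    and pb: "is_pullback C x a (P, r1, r2)"
    and "f \<in> hom C P (Dom C p)" "p \<cdot> f = x \<cdot> r1"
  shows "\<exists>!g. g \<in> hom C (Dom C x) (Dom C (local_hom a p)) \<and> local_hom a p \<cdot> g = x \<and>
    local_app a p (g \<cdot> r1) r2 = f"
proof -
  let ?S = "slice C (Cod C p)"
  interpret S: product_category ?S
    by (rule slice_product_category) (use assms in simp)
  note ea = slice_exponentiable[OF assms(1,3)]
  let ?h = "local_hom a p" and ?Q = "prd ?S x a"
  let ?s1 = "underlying (prd1 ?S x a)" and ?s2 = "underlying (prd2 ?S x a)"
  have h: "?h \<in> Arr C" "Cod C ?h = Cod C p" using assms by simp_all
  have r: "P \<in> Obj C" "r1 \<in> Arr C" "Dom C r1 = P" "Cod C r1 = Dom C x"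
    "r2 \<in> Arr C" "Dom C r2 = P" "Cod C r2 = Dom C a" and sq: "x \<cdot> r1 = a \<cdot> r2"
    using pb by (auto simp: is_pullback_def)
  have xa: "x \<in> Obj ?S" "a \<in> Obj ?S" using assms by auto
  note prdS = S.prd_types[OF xa]
  have s: "?s1 \<in> Arr C" "Dom C ?s1 = Dom C ?Q" "Cod C ?s1 = Dom C x" "x \<cdot> ?s1 = ?Q"
    "?s2 \<in> Arr C" "Dom C ?s2 = Dom C ?Q" "Cod C ?s2 = Dom C a" "a \<cdot> ?s2 = ?Q"
    using underlying_types[OF prdS(2)] underlying_types[OF prdS(5)] prdS by simp_all
  have Q: "?Q \<in> Arr C" "Cod C ?Q = Cod C p" using prdS(1) by simp_all
  have prdS_eq: "prd1 ?S x a = (?Q, ?s1, x)" "prd2 ?S x a = (?Q, ?s2, a)"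
    using slice_arrow_eq[of C "Cod C p" "prd1 ?S x a"]
      slice_arrow_eq[of C "Cod C p" "prd2 ?S x a"] prdS by simp_all

  \<comment> \<open>The given pullback and the underlying object of the product in the slice represent the
     same cones, so there are comparison maps between them.\<close>
  obtain k where k: "k \<in> Arr C" "Dom C k = Dom C ?Q" "Cod C k = P" "r1 \<cdot> k = ?s1" "r2 \<cdot> k = ?s2"
    using pullback_ex1[OF pb s(1,5)] s by auto
  let ?c = "a \<cdot> r2"
  let ?l = "pair ?S (?c, r1, x) (?c, r2, a)"
  let ?l' = "underlying ?l"
  have cones: "(?c, r1, x) \<in> Arr ?S" "(?c, r2, a) \<in> Arr ?S" using r sq assms by auto
  have l: "?l \<in> Arr ?S" "Dom ?S ?l = ?c" "Cod ?S ?l = ?Q"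
    using S.pair_types[OF cones] by simp_all
  have l': "?l' \<in> Arr C" "Dom C ?l' = P" "Cod C ?l' = Dom C ?Q"
    using underlying_types[OF l(1)] l r assms by simp_all
  have "prd1 ?S x a \<cdot>\<^bsub>?S\<^esub> ?l = (?c, r1, x)" "prd2 ?S x a \<cdot>\<^bsub>?S\<^esub> ?l = (?c, r2, a)"
    using S.prd_pair[OF cones] by simp_all
  then have sl: "?s1 \<cdot> ?l' = r1" "?s2 \<cdot> ?l' = r2"
    by (metis underlying_Comp underlying_simp)+
  have kl: "k \<cdot> ?l' = Id C P"
  proof (rule pullback_ext[OF pb assms(4,1), of _ P])
    show "r1 \<cdot> (k \<cdot> ?l') = r1 \<cdot> Id C P"
      using square_Comp[of r1 k "?s1" "Id C (Dom C ?Q)" ?l'] k r s sl l' Q by simp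
    show "r2 \<cdot> (k \<cdot> ?l') = r2 \<cdot> Id C P"
      using square_Comp[of r2 k "?s2" "Id C (Dom C ?Q)" ?l'] k r s sl l' Q by simp
  qed (use k l' r in simp_all)

  \<comment> \<open>Carried along the comparison map, \<open>f\<close> becomes an arrow out of the product in the slice.\<close>
  let ?f = "(?Q, f \<cdot> k, p)"
  have "p \<cdot> (f \<cdot> k) = ?Q"
    using square_Comp[of p f x r1 k] assms k r s by simp
  then have f: "?f \<in> hom ?S (prd ?S x a) p" using assms k Q by auto
  have ex1: "\<exists>!t. t \<in> hom ?S x (ihom ?S a p) \<and>
      ev ?S a p \<cdot>\<^bsub>?S\<^esub> prd_map ?S t (Id ?S a) = ?f"
    by (rule S.ihom_ex1[OF ea f xa(1)])
  have key: "ev ?S a p \<cdot>\<^bsub>?S\<^esub> prd_map ?S (x, g, ?h) (Id ?S a) = ?f \<longleftrightarrow>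
      local_app a p (g \<cdot> r1) r2 = f"
    if g: "g \<in> Arr C" "Dom C g = Dom C x" "Cod C g = Dom C ?h" "?h \<cdot> g = x" for g
  proof -
    have hg1: "?h \<cdot> (g \<cdot> ?s1) = ?Q" and hgr: "?h \<cdot> (g \<cdot> r1) = a \<cdot> r2"
      using square_Comp[of ?h g x "Id C (Dom C x)" ?s1]
        square_Comp[of ?h g x "Id C (Dom C x)" r1] g h s r sq assms by simp_all
    let ?t = "ev ?S a p \<cdot>\<^bsub>?S\<^esub> prd_map ?S (x, g, ?h) (Id ?S a)"
    have "(x, g, ?h) \<cdot>\<^bsub>?S\<^esub> prd1 ?S x a = (?Q, g \<cdot> ?s1, ?h)"
      by (subst prdS_eq(1)) simp
    moreover have "Id ?S a \<cdot>\<^bsub>?S\<^esub> prd2 ?S x a = (?Q, ?s2, a)"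
      by (subst prdS_eq(2)) (use s assms in simp)
    ultimately have "prd_map ?S (x, g, ?h) (Id ?S a) = pair ?S (?Q, g \<cdot> ?s1, ?h) (?Q, ?s2, a)"
      unfolding prd_map_def by simp
    then have u: "underlying ?t = local_app a p (g \<cdot> ?s1) ?s2"
      using hg1 by (simp add: local_app_def Let_def)
    have gs: "(?Q, g \<cdot> ?s1, ?h) \<in> Arr ?S" "(?Q, ?s2, a) \<in> Arr ?S"
      using g s h hg1 Q assms by simp_all
    have "Dom ?S ?t = ?Q" "Cod ?S ?t = p"
      using \<open>prd_map ?S (x, g, ?h) (Id ?S a) = _\<close> S.pair_types[OF gs] S.ihom_types[OF ea, of p]
        assms by (simp_all add: local_hom_def)
    then have "?t = ?f \<longleftrightarrow> local_app a p (g \<cdot> ?s1) ?s2 = f \<cdot> k"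
      using u slice_arrow_eq[of C "Cod C p" ?t] by (metis underlying_simp)
    also have "\<dots> \<longleftrightarrow> local_app a p (g \<cdot> r1) r2 = f"
    proof
      assume "local_app a p (g \<cdot> r1) r2 = f"
      then show "local_app a p (g \<cdot> ?s1) ?s2 = f \<cdot> k"
        using local_app_Comp[of a p "g \<cdot> r1" r2 k] assms g r k hgr by simp
    next
      assume e: "local_app a p (g \<cdot> ?s1) ?s2 = f \<cdot> k"
      have "local_app a p (g \<cdot> r1) r2 = local_app a p (g \<cdot> ?s1) ?s2 \<cdot> ?l'"
        using local_app_Comp[of a p "g \<cdot> ?s1" ?s2 ?l'] assms g s l' sl hg1 by simp
      also have "\<dots> = f" using e kl assms k l' by simp
      finally show "local_app a p (g \<cdot> r1) r2 = f" .
    qed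
    finally show ?thesis .
  qed
  have arr: "(x, g, ?h) \<in> hom ?S x (ihom ?S a p) \<longleftrightarrow>
      g \<in> Arr C \<and> Dom C g = Dom C x \<and> Cod C g = Dom C ?h \<and> ?h \<cdot> g = x" for g
    using assms h by (auto simp: local_hom_def)
  obtain t where t: "t \<in> hom ?S x (ihom ?S a p)"
      "ev ?S a p \<cdot>\<^bsub>?S\<^esub> prd_map ?S t (Id ?S a) = ?f"
    and uniq: "\<And>t'. t' \<in> hom ?S x (ihom ?S a p) \<Longrightarrow>
      ev ?S a p \<cdot>\<^bsub>?S\<^esub> prd_map ?S t' (Id ?S a) = ?f \<Longrightarrow> t' = t"
    using ex1 by blast
  have t_eq: "t = (x, underlying t, ?h)"
    using t(1) slice_arrow_eq[of C "Cod C p" t] by (simp add: local_hom_def)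
  show ?thesis
  proof (rule ex1I[of _ "underlying t"])
    have g: "underlying t \<in> Arr C \<and> Dom C (underlying t) = Dom C x \<and>
        Cod C (underlying t) = Dom C ?h \<and> ?h \<cdot> underlying t = x"
      using arr[of "underlying t"] t(1) t_eq by metis
    then show "underlying t \<in> hom C (Dom C x) (Dom C ?h) \<and> ?h \<cdot> underlying t = x \<and>
        local_app a p (underlying t \<cdot> r1) r2 = f"
      using key[of "underlying t"] t(2) t_eq by (metis hom_iff)
  next
    fix g
    assume g: "g \<in> hom C (Dom C x) (Dom C ?h) \<and> ?h \<cdot> g = x \<and> local_app a p (g \<cdot> r1) r2 = f"
    then have "(x, g, ?h) = t"
      by (intro uniq) (metis arr hom_iff, metis key hom_iff)
    then show "g = underlying t" by (metis underlying_simp)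
  qed
qed

section \<open>Products distribute over coproducts\<close>

text \<open>
  Local cartesian closure yields cartesian closure: \<open>X\<close> and \<open>D\<close> are objects of the slice over
  the terminal object, and \<open>D \<times> X\<close> is their product there. The order of the factors fits the
  maps \<open>D \<times> j\<close> by which homotopies are built.
\<close>

lemma curry_left:
  assumes "D \<in> Obj C" "X \<in> Obj C" "f \<in> Arr C" "Dom C f = prd C D X"
  shows "\<exists>!g. g \<in> hom C X (Dom C (local_hom (bang C D) (bang C (Cod C f)))) \<and>
    local_app (bang C D) (bang C (Cod C f)) (g \<cdot> prd2 C D X) (prd1 C D X) = f"
proof -
  let ?K = "local_hom (bang C D) (bang C (Cod C f))"
  have K: "?K \<in> Arr C" "Cod C ?K = one C" using assms by simp_all
  have "is_product C X D (prd C D X, prd2 C D X, prd1 C D X)"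
    using prd_is_product[OF assms(1,2)] unfolding is_product_def prod.case by blast
  then have "is_pullback C (bang C X) (bang C D) (prd C D X, prd2 C D X, prd1 C D X)"
    by (rule product_is_pullback_over_one[OF assms(2,1)])
  then have "\<exists>!g. g \<in> hom C (Dom C (bang C X)) (Dom C ?K) \<and> ?K \<cdot> g = bang C X \<and>
      local_app (bang C D) (bang C (Cod C f)) (g \<cdot> prd2 C D X) (prd1 C D X) = f"
    by (intro local_exponential) (use assms in simp_all)
  moreover have "?K \<cdot> g = bang C X" if "g \<in> hom C X (Dom C ?K)" for g
    by (rule to_one_unique) (use that K assms in auto)
  ultimately show ?thesis using assms by (auto simp del: hom_iff)
qed

text \<open>
  The functor \<open>D \<times> -\<close> preserves coproducts because it has a right adjoint: maps out of
  \<open>D \<times> S\<close> are maps out of \<open>S\<close>, which are determined by their restrictions to the summands.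
\<close>

lemma prd_coproduct:
  assumes D: "D \<in> Obj C" and X: "X \<in> Obj C" and Y: "Y \<in> Obj C"
    and cop: "is_coproduct C X Y (S, m, n)"
  shows "is_coproduct C (prd C D X) (prd C D Y)
    (prd C D S, prd_map C (Id C D) m, prd_map C (Id C D) n)"
proof -
  have mn: "S \<in> Obj C" "m \<in> Arr C" "Dom C m = X" "Cod C m = S"
    "n \<in> Arr C" "Dom C n = Y" "Cod C n = S"
    using cop by (auto simp: is_coproduct_def)
  have copair: "\<exists>!h. h \<in> hom C S Z \<and> h \<cdot> m = f \<and> h \<cdot> n = g"
    if "f \<in> hom C X Z" "g \<in> hom C Y Z" for f g Z
  proof -
    have "Z \<in> Obj C" using that by auto
    then show ?thesis using cop that unfolding is_coproduct_def by blast
  qed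
  have "\<exists>!h. h \<in> hom C (prd C D S) Z \<and> h \<cdot> prd_map C (Id C D) m = f \<and>
      h \<cdot> prd_map C (Id C D) n = g"
    if f: "f \<in> hom C (prd C D X) Z" and g: "g \<in> hom C (prd C D Y) Z" for f g Z
  proof -
    have Z: "Z \<in> Obj C" using f by auto
    let ?a = "bang C D" and ?p = "bang C Z"
    let ?K = "local_hom ?a ?p"
    let ?app = "\<lambda>W k. local_app ?a ?p (k \<cdot> prd2 C D W) (prd1 C D W)"
    have K: "?K \<in> Arr C" "Cod C ?K = one C" using D Z by simp_all
    have curry: "\<exists>!k. k \<in> hom C W (Dom C ?K) \<and> ?app W k = h"
      if "W \<in> Obj C" "h \<in> hom C (prd C D W) Z" for W h
      using curry_left[OF D, of W h] that by simp
    have app_types: "?app W k \<in> hom C (prd C D W) Z"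
      if "W \<in> Obj C" "k \<in> hom C W (Dom C ?K)" for W k
    proof -
      have "?K \<cdot> (k \<cdot> prd2 C D W) = ?a \<cdot> prd1 C D W"
        by (rule to_one_unique) (use that K D in auto)
      then show ?thesis using that K D Z by simp
    qed
    have app_Comp: "?app S k \<cdot> prd_map C (Id C D) w = ?app (Dom C w) (k \<cdot> w)"
      if "w \<in> Arr C" "Cod C w = S" "k \<in> hom C S (Dom C ?K)" for w k
    proof -
      have "?K \<cdot> (k \<cdot> prd2 C D S) = ?a \<cdot> prd1 C D S"
        by (rule to_one_unique) (use that K D mn in auto)
      then show ?thesis using that K D Z mn by (simp add: prd_map_def local_app_Comp)
    qed
    obtain f' where f': "f' \<in> hom C X (Dom C ?K)" "?app X f' = f" using curry[OF X f] by blast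
    obtain g' where g': "g' \<in> hom C Y (Dom C ?K)" "?app Y g' = g" using curry[OF Y g] by blast
    obtain c where c: "c \<in> hom C S (Dom C ?K)" "c \<cdot> m = f'" "c \<cdot> n = g'"
      using copair[OF f'(1) g'(1)] by blast
    \<comment> \<open>The copairing is the uncurried copairing of the two curried maps.\<close>
    show ?thesis
    proof (rule ex1I[of _ "?app S c"])
      show "?app S c \<in> hom C (prd C D S) Z \<and> ?app S c \<cdot> prd_map C (Id C D) m = f \<and>
          ?app S c \<cdot> prd_map C (Id C D) n = g"
        using app_types[OF mn(1) c(1)] app_Comp[OF _ _ c(1)] mn c f' g' by (simp del: hom_iff)
    next
      fix h
      assume h: "h \<in> hom C (prd C D S) Z \<and> h \<cdot> prd_map C (Id C D) m = f \<and>
          h \<cdot> prd_map C (Id C D) n = g"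
      then obtain k where k: "k \<in> hom C S (Dom C ?K)" "?app S k = h"
        using curry[OF mn(1)] by blast
      have km: "k \<cdot> m \<in> hom C X (Dom C ?K)" and kn: "k \<cdot> n \<in> hom C Y (Dom C ?K)"
        using k mn by auto
      have "?app X (k \<cdot> m) = f" "?app Y (k \<cdot> n) = g"
        using app_Comp[OF _ _ k(1), of m] app_Comp[OF _ _ k(1), of n] mn k h
        by (simp_all del: hom_iff)
      then have "k \<cdot> m = f'" "k \<cdot> n = g'"
        using curry[OF X f] curry[OF Y g] km kn f' g' by blast+
      then have "k = c" using copair[OF f'(1) g'(1)] k c by blast
      then show "h = ?app S c" using k by simp
    qed
  qed
  moreover have "prd C D S \<in> Obj C" "prd_map C (Id C D) m \<in> hom C (prd C D X) (prd C D S)"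
    "prd_map C (Id C D) n \<in> hom C (prd C D Y) (prd C D S)"
    using D X Y mn by (simp_all add: prd_map_def)
  ultimately show ?thesis unfolding is_coproduct_def prod.case by blast
qed

section \<open>Homotopies by lifting against the cylinder inclusion\<close>

lemma coprd_is_coproduct:
  assumes "\<exists>S. is_coproduct C X Y S"
  shows "is_coproduct C X Y (coprd C X Y, inj1 C X Y, inj2 C X Y)"
  using someI_ex[OF assms] by (simp add: coprd_def inj1_def inj2_def)

text \<open>
  Two maps that agree after composition with \<open>k\<close> are homotopic over the codomain of \<open>k\<close>. They
  form one map out of \<open>D \<times> (1 + 1)\<close>; with the constant homotopy of their common image this is a
  lifting problem of \<open>D \<times> j\<close> against \<open>k\<close>, and a solution is the homotopy.
\<close>

lemma fibrewise_homotopy: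
  assumes cop: "\<exists>S. is_coproduct C (one C) (one C) S"
    and j: "j \<in> hom C (coprd C (one C) (one C)) I"
    and k: "k \<in> Arr C" and m: "m \<in> hom C D (Dom C k)" and n: "n \<in> hom C D (Dom C k)"
    and kmn: "k \<cdot> m = k \<cdot> n"
    and lifts: "lifts_against C (prd_map C (Id C D) j) k"
  obtains h where "h \<in> hom C (prd C D I) (Dom C k)" "k \<cdot> h = k \<cdot> (m \<cdot> prd1 C D I)"
    "h \<cdot> pair C (Id C D) (j \<cdot> (inj1 C (one C) (one C) \<cdot> bang C D)) = m"
    "h \<cdot> pair C (Id C D) (j \<cdot> (inj2 C (one C) (one C) \<cdot> bang C D)) = n"
proof -
  let ?S = "coprd C (one C) (one C)"
  let ?i1 = "inj1 C (one C) (one C)" and ?i2 = "inj2 C (one C) (one C)"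
  have D: "D \<in> Obj C" using m by auto
  have cop': "is_coproduct C (one C) (one C) (?S, ?i1, ?i2)"
    by (rule coprd_is_coproduct[OF cop])
  then have S: "?S \<in> Obj C" "?i1 \<in> Arr C" "Dom C ?i1 = one C" "Cod C ?i1 = ?S"
    "?i2 \<in> Arr C" "Dom C ?i2 = one C" "Cod C ?i2 = ?S"
    by (auto simp: is_coproduct_def)
  have I: "I \<in> Obj C" using j by auto
  let ?j1 = "prd_map C (Id C D) ?i1" and ?j2 = "prd_map C (Id C D) ?i2"
  have copair: "\<exists>!h. h \<in> hom C (prd C D ?S) Z \<and> h \<cdot> ?j1 = f \<and> h \<cdot> ?j2 = g"
    if "f \<in> hom C (prd C D (one C)) Z" "g \<in> hom C (prd C D (one C)) Z" for f g Z
  proof -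
    have "Z \<in> Obj C" using that by auto
    then show ?thesis
      using prd_coproduct[OF D one_Obj one_Obj cop'] that unfolding is_coproduct_def by blast
  qed
  let ?p = "prd1 C D (one C)"
  obtain c where c: "c \<in> hom C (prd C D ?S) (Dom C k)" "c \<cdot> ?j1 = m \<cdot> ?p" "c \<cdot> ?j2 = n \<cdot> ?p"
    using copair[of "m \<cdot> ?p" "Dom C k" "n \<cdot> ?p"] m n D by auto
  have types: "?j1 \<in> Arr C" "Dom C ?j1 = prd C D (one C)" "Cod C ?j1 = prd C D ?S"
    "?j2 \<in> Arr C" "Dom C ?j2 = prd C D (one C)" "Cod C ?j2 = prd C D ?S"
    "prd_map C (Id C D) j \<in> Arr C" "Dom C (prd_map C (Id C D) j) = prd C D ?S"
    "Cod C (prd_map C (Id C D) j) = prd C D I"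
    using D S j I by (auto simp: prd_map_def)
  let ?const = "k \<cdot> (m \<cdot> prd1 C D I)"
  \<comment> \<open>The lifting problem commutes, as may be checked on the two summands of \<open>D \<times> (1 + 1)\<close>.\<close>
  have "k \<cdot> c = ?const \<cdot> prd_map C (Id C D) j"
  proof -
    have "\<exists>!h. h \<in> hom C (prd C D ?S) (Cod C k) \<and>
        h \<cdot> ?j1 = k \<cdot> (m \<cdot> ?p) \<and> h \<cdot> ?j2 = k \<cdot> (m \<cdot> ?p)"
      by (rule copair) (use m k D in simp_all)
    moreover have "k \<cdot> c \<in> hom C (prd C D ?S) (Cod C k)"
      "?const \<cdot> prd_map C (Id C D) j \<in> hom C (prd C D ?S) (Cod C k)"
      using k c m types D I by simp_all
    moreover have "(k \<cdot> c) \<cdot> ?j1 = k \<cdot> (m \<cdot> ?p)" "(k \<cdot> c) \<cdot> ?j2 = k \<cdot> (m \<cdot> ?p)"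
      using k c m n types D square_Comp[OF kmn, of ?p] by simp_all
    moreover have "(?const \<cdot> prd_map C (Id C D) j) \<cdot> ?j1 = k \<cdot> (m \<cdot> ?p)"
      "(?const \<cdot> prd_map C (Id C D) j) \<cdot> ?j2 = k \<cdot> (m \<cdot> ?p)"
      using k m D I j S by (simp_all add: prd_map_def)
    ultimately show ?thesis by blast
  qed
  moreover have "c \<in> hom C (Dom C (prd_map C (Id C D) j)) (Dom C k)"
    "?const \<in> hom C (Cod C (prd_map C (Id C D) j)) (Cod C k)"
    using c k m types D I by simp_all
  ultimately have "\<exists>h \<in> hom C (Cod C (prd_map C (Id C D) j)) (Dom C k).
      h \<cdot> prd_map C (Id C D) j = c \<and> k \<cdot> h = ?const"
    using lifts unfolding lifts_against_def by blast
  then obtain h where h: "h \<in> hom C (prd C D I) (Dom C k)" "h \<cdot> prd_map C (Id C D) j = c"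
      "k \<cdot> h = ?const"
    unfolding types(9) by blast
  have "h \<cdot> pair C (Id C D) (j \<cdot> (?i1 \<cdot> bang C D)) = m"
  proof -
    have "h \<cdot> pair C (Id C D) (j \<cdot> (?i1 \<cdot> bang C D)) =
        ((h \<cdot> prd_map C (Id C D) j) \<cdot> ?j1) \<cdot> pair C (Id C D) (bang C D)"
      using h(1) D I j S by (simp add: prd_map_def)
    also have "\<dots> = m" using h(2) c(2) m D by simp
    finally show ?thesis .
  qed
  moreover have "h \<cdot> pair C (Id C D) (j \<cdot> (?i2 \<cdot> bang C D)) = n"
  proof -
    have "h \<cdot> pair C (Id C D) (j \<cdot> (?i2 \<cdot> bang C D)) =
        ((h \<cdot> prd_map C (Id C D) j) \<cdot> ?j2) \<cdot> pair C (Id C D) (bang C D)"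
      using h(1) D I j S by (simp add: prd_map_def)
    also have "\<dots> = n" using h(2) c(3) n D by simp
    finally show ?thesis .
  qed
  ultimately show thesis using that h by blast
qed

section \<open>Maps into the fibred path object\<close>

text \<open>
  Evaluation of a path at \<open>t\<close> is application of the generic path, the identity of the path
  object, to the constant element \<open>t\<close> of \<open>B \<times> I\<close>.
\<close>

lemma path_ev_eq_local_app:
  assumes "p \<in> Arr C" "I \<in> Obj C" "t \<in> Arr C" "Cod C t = I" "Dom C t = one C"
  shows "path_proj C I p = local_hom (prd1 C (Cod C p) I) p"
    "path_ev C I p t = local_app (prd1 C (Cod C p) I) p (Id C (path_object C I p))
      (pair C (path_proj C I p) (t \<cdot> bang C (path_object C I p)))"
proof -
  show eq: "path_proj C I p = local_hom (prd1 C (Cod C p) I) p"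
    by (simp add: path_proj_def local_hom_def)
  have "local_hom (prd1 C (Cod C p) I) p \<in> Arr C" using assms by simp
  then show "path_ev C I p t = local_app (prd1 C (Cod C p) I) p (Id C (path_object C I p))
      (pair C (path_proj C I p) (t \<cdot> bang C (path_object C I p)))"
    by (simp add: path_ev_def local_app_def Let_def path_object_def eq)
qed

lemma path_types [simp]:
  assumes "p \<in> Arr C" "I \<in> Obj C"
  shows "path_object C I p \<in> Obj C" "path_proj C I p \<in> Arr C"
    "Dom C (path_proj C I p) = path_object C I p" "Cod C (path_proj C I p) = Cod C p"
proof -
  show *: "path_proj C I p \<in> Arr C" "Cod C (path_proj C I p) = Cod C p"
    using local_hom_types[of "prd1 C (Cod C p) I" p] assms
    by (simp_all add: path_proj_def local_hom_def)
  then show "path_object C I p \<in> Obj C" "Dom C (path_proj C I p) = path_object C I p"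
    by (simp_all add: path_object_def)
qed

lemma path_ev_types [simp]:
  assumes "p \<in> Arr C" "I \<in> Obj C" "t \<in> Arr C" "Cod C t = I" "Dom C t = one C"
  shows "path_ev C I p t \<in> Arr C" "Dom C (path_ev C I p t) = path_object C I p"
    "Cod C (path_ev C I p t) = Dom C p" "p \<cdot> path_ev C I p t = path_proj C I p"
proof -
  let ?a = "prd1 C (Cod C p) I" and ?O = "path_object C I p"
  note eq = path_ev_eq_local_app[OF assms]
  have "path_proj C I p \<cdot> Id C ?O = ?a \<cdot> pair C (path_proj C I p) (t \<cdot> bang C ?O)"
    using assms by simp
  then show "path_ev C I p t \<in> Arr C" "Dom C (path_ev C I p t) = ?O"
    "Cod C (path_ev C I p t) = Dom C p" "p \<cdot> path_ev C I p t = path_proj C I p"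
    unfolding eq(2)
    using local_app_types[of ?a p "Id C ?O" "pair C (path_proj C I p) (t \<cdot> bang C ?O)"] assms
    by (simp_all flip: eq(1))
qed

text \<open>
  A homotopy \<open>f : W \<times> I \<rightarrow> E\<close> that is constant over \<open>B\<close> is a map over \<open>B\<close> from \<open>W \<times> I\<close>, the
  product of \<open>W\<close> and \<open>B \<times> I\<close> in the slice. It therefore corresponds to a map from \<open>W\<close> to the
  path object, and evaluation of that map at a point \<open>t\<close> restricts \<open>f\<close> to \<open>t\<close>.
\<close>

lemma path_transpose:
  assumes p: "p \<in> Arr C" and I: "I \<in> Obj C" and w: "w \<in> Arr C" "Cod C w = Cod C p"
    and f: "f \<in> hom C (prd C (Dom C w) I) (Dom C p)" "p \<cdot> f = w \<cdot> prd1 C (Dom C w) I"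
  obtains g where "g \<in> hom C (Dom C w) (path_object C I p)"
    "\<And>t. t \<in> hom C (one C) I \<Longrightarrow>
      path_ev C I p t \<cdot> g = f \<cdot> pair C (Id C (Dom C w)) (t \<cdot> bang C (Dom C w))"
proof -
  let ?W = "Dom C w" and ?O = "path_object C I p" and ?h = "path_proj C I p"
  let ?a = "prd1 C (Cod C p) I"
  let ?r1 = "prd1 C ?W I" and ?r2 = "pair C (w \<cdot> prd1 C ?W I) (prd2 C ?W I)"
  have h: "local_hom ?a p = ?h" by (simp add: path_proj_def local_hom_def)
  have W: "?W \<in> Obj C" using w by simp
  have pbk: "is_pullback C w ?a (prd C ?W I, ?r1, ?r2)"
    using prd_base_change_is_pullback[OF w(1) I] w by simp
  have "\<exists>!g. g \<in> hom C ?W (Dom C (local_hom ?a p)) \<and> local_hom ?a p \<cdot> g = w \<and>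
      local_app ?a p (g \<cdot> ?r1) ?r2 = f"
    by (rule local_exponential[OF _ _ _ _ _ pbk]) (use assms in simp_all)
  then obtain g where g: "g \<in> Arr C" "Dom C g = ?W" "Cod C g = ?O" "?h \<cdot> g = w"
    and gf: "local_app ?a p (g \<cdot> ?r1) ?r2 = f"
    unfolding h using p I by auto
  have "path_ev C I p t \<cdot> g = f \<cdot> pair C (Id C ?W) (t \<cdot> bang C ?W)"
    if t: "t \<in> hom C (one C) I" for t
  proof -
    have tt: "t \<in> Arr C" "Dom C t = one C" "Cod C t = I" using t by auto
    have sq: "?h \<cdot> (g \<cdot> ?r1) = w \<cdot> ?r1"
      using square_Comp[of ?h g w "Id C ?W" ?r1] g p I w by simp
    have "path_ev C I p t \<cdot> g =
        local_app ?a p (Id C ?O) (pair C ?h (t \<cdot> bang C ?O)) \<cdot> g"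
      using path_ev_eq_local_app(2)[OF p I tt(1,3,2)] by simp
    also have "\<dots> = local_app ?a p g (pair C w (t \<cdot> bang C ?W))"
      using local_app_Comp[of ?a p "Id C ?O" "pair C ?h (t \<cdot> bang C ?O)" g] h tt g p I by simp
    also have "\<dots> = local_app ?a p (g \<cdot> ?r1) ?r2 \<cdot> pair C (Id C ?W) (t \<cdot> bang C ?W)"
      using local_app_Comp[of ?a p "g \<cdot> ?r1" ?r2 "pair C (Id C ?W) (t \<cdot> bang C ?W)"]
        h tt g p I w sq by simp
    finally show ?thesis using gf by simp
  qed
  then show thesis using that g by simp
qed

text \<open>
  The same correspondence for homotopies of maps into $[V,E]$: paths in $[V,E]$ that are constant
  over $[V,B]$ are families, indexed by \<open>V\<close>, of fibrewise paths in \<open>E\<close>.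
\<close>

lemma ihom_path_transpose:
  assumes V: "exponentiable C V" and p: "p \<in> Arr C" and I: "I \<in> Obj C"
    and h: "h \<in> hom C (prd C D I) (ihom C V (Dom C p))" and D: "D \<in> Obj C"
    and n: "n \<in> hom C D (ihom C V (Cod C p))"
    and const: "ihom_post C V p \<cdot> h = n \<cdot> prd1 C D I"
  obtains H where "H \<in> hom C D (ihom C V (path_object C I p))"
    "\<And>t. t \<in> hom C (one C) I \<Longrightarrow>
      ihom_post C V (path_ev C I p t) \<cdot> H = h \<cdot> pair C (Id C D) (t \<cdot> bang C D)"
proof -
  let ?W = "prd C D V" and ?E = "Dom C p" and ?O = "path_object C I p"
  let ?d = "prd1 C D V \<cdot> prd1 C ?W I" and ?v = "prd2 C D V \<cdot> prd1 C ?W I"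
  let ?w = "ev C V (Cod C p) \<cdot> pair C (n \<cdot> prd1 C D V) (prd2 C D V)"
  \<comment> \<open>The transposed homotopy on \<open>(D \<times> V) \<times> I\<close>, and its constant image \<open>w\<close> in the base.\<close>
  let ?f = "ev C V ?E \<cdot> pair C (h \<cdot> pair C ?d (prd2 C ?W I)) ?v"
  have O: "V \<in> Obj C" "?W \<in> Obj C" using V D by simp_all
  have w: "?w \<in> Arr C" "Dom C ?w = ?W" "Cod C ?w = Cod C p" using V p D n O by simp_all
  have f: "?f \<in> hom C (prd C ?W I) ?E" using V p D I h O by simp
  have "ihom_post C V p \<cdot> (h \<cdot> pair C ?d (prd2 C ?W I)) = n \<cdot> ?d"
    using square_Comp[OF const, of "pair C ?d (prd2 C ?W I)"] V p D I h O n by simp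
  then have "p \<cdot> ?f = ?w \<cdot> prd1 C ?W I"
    using ev_ihom_post[OF V p refl, of "h \<cdot> pair C ?d (prd2 C ?W I)" ?v] V p D I h O n by simp
  then obtain g where g: "g \<in> hom C ?W ?O" "\<And>t. t \<in> hom C (one C) I \<Longrightarrow>
      path_ev C I p t \<cdot> g = ?f \<cdot> pair C (Id C ?W) (t \<cdot> bang C ?W)"
    using path_transpose[OF p I w(1,3), of ?f] f w by metis
  let ?H = "transpose C D V ?O g"
  have H: "?H \<in> Arr C" "Dom C ?H = D" "Cod C ?H = ihom C V ?O"
    using V D g by simp_all
  have "ihom_post C V (path_ev C I p t) \<cdot> ?H = h \<cdot> pair C (Id C D) (t \<cdot> bang C D)"
    if t: "t \<in> hom C (one C) I" for t
  proof (rule ihom_ext[of V ?E _ D])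
    have "ev C V ?E \<cdot> pair C ((ihom_post C V (path_ev C I p t) \<cdot> ?H) \<cdot> prd1 C D V) (prd2 C D V) =
        path_ev C I p t \<cdot> g"
      using V p D I H O t g(1) by simp
    also have "\<dots> = ?f \<cdot> pair C (Id C ?W) (t \<cdot> bang C ?W)" by (rule g(2)[OF t])
    also have "\<dots> = ev C V ?E \<cdot> pair C ((h \<cdot> pair C (Id C D) (t \<cdot> bang C D)) \<cdot> prd1 C D V) (prd2 C D V)"
      using V p D I h O t by simp
    finally show "ev C V ?E \<cdot> pair C ((ihom_post C V (path_ev C I p t) \<cdot> ?H) \<cdot> prd1 C D V) (prd2 C D V) =
      ev C V ?E \<cdot> pair C ((h \<cdot> pair C (Id C D) (t \<cdot> bang C D)) \<cdot> prd1 C D V) (prd2 C D V)" .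
  qed (use V p D I H h O t in simp_all)
  then show thesis using that[of ?H] H by simp
qed

section \<open>Lifting structures as maps\<close>

lemma pullback_power_props:
  assumes "exponentiable C (Dom C i)" "exponentiable C (Cod C i)" "i \<in> Arr C" "p \<in> Arr C"
  shows "pullback_power C i p \<in> Arr C"
    "Dom C (pullback_power C i p) = ihom C (Cod C i) (Dom C p)"
    "pb1 C (ihom_post C (Dom C i) p) (ihom_pre C i (Cod C p)) \<cdot> pullback_power C i p =
      ihom_pre C i (Dom C p)"
    "pb2 C (ihom_post C (Dom C i) p) (ihom_pre C i (Cod C p)) \<cdot> pullback_power C i p =
      ihom_post C (Cod C i) p"
    "Cod C (pullback_power C i p) = pb C (ihom_post C (Dom C i) p) (ihom_pre C i (Cod C p))"
  unfolding pullback_power_def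
  using pb_pair_props[OF _ _ _ ihom_pre_post[OF assms, symmetric]] assms by simp_all

lemma pullback_power_Comp_eqI:
  assumes "exponentiable C (Dom C i)" "exponentiable C (Cod C i)" "i \<in> Arr C" "p \<in> Arr C"
    and "m \<in> hom C D (ihom C (Cod C i) (Dom C p))" "n \<in> hom C D (ihom C (Cod C i) (Dom C p))"
    and "ihom_pre C i (Dom C p) \<cdot> m = ihom_pre C i (Dom C p) \<cdot> n"
    and "ihom_post C (Cod C i) p \<cdot> m = ihom_post C (Cod C i) p \<cdot> n"
  shows "pullback_power C i p \<cdot> m = pullback_power C i p \<cdot> n"
proof -
  let ?f = "ihom_post C (Dom C i) p" and ?g = "ihom_pre C i (Cod C p)"
  have fg: "?f \<in> Arr C" "?g \<in> Arr C" "Cod C ?f = Cod C ?g" using assms by simp_all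
  note k = pullback_power_props[OF assms(1-4)]
  show ?thesis
  proof (rule pullback_ext[OF pb_is_pullback[OF fg] fg(1,2), of _ D])
    show "pb1 C ?f ?g \<cdot> (pullback_power C i p \<cdot> m) = pb1 C ?f ?g \<cdot> (pullback_power C i p \<cdot> n)"
      using k fg assms by (simp flip: Comp_assoc_right)
    show "pb2 C ?f ?g \<cdot> (pullback_power C i p \<cdot> m) = pb2 C ?f ?g \<cdot> (pullback_power C i p \<cdot> n)"
      using k fg assms by (simp flip: Comp_assoc_right)
  qed (use k assms in simp_all)
qed

lemma lift_leg1_types [simp]:
  assumes "exponentiable C (Dom C i)" "p \<in> Arr C"
  shows "lift_leg1 C i p \<in> Arr C" "Dom C (lift_leg1 C i p) = ihom C (Dom C i) (Dom C p)"
    "Cod C (lift_leg1 C i p) = ihom C (Dom C i) (Cod C p)"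
  using assms by (simp_all add: lift_leg1_def)

lemma lift_leg2_types [simp]:
  assumes "exponentiable C (Dom C i)" "exponentiable C (Cod C i)" "i \<in> Arr C" "q \<in> Arr C"
  shows "lift_leg2 C i q \<in> Arr C" "Dom C (lift_leg2 C i q) = ihom C (Cod C i) (Dom C q)"
    "Cod C (lift_leg2 C i q) = ihom C (Dom C i) (Cod C q)"
  using assms by (simp_all add: lift_leg2_def)

lemma lift_dom_types [simp]:
  assumes "exponentiable C (Dom C i)" "exponentiable C (Cod C i)" "i \<in> Arr C"
    and "p \<in> Arr C" "q \<in> Arr C" "Cod C q = Cod C p"
  shows "lift_dom C i p q \<in> Obj C"
    "lift_pr1 C i p q \<in> Arr C" "Dom C (lift_pr1 C i p q) = lift_dom C i p q"
    "Cod C (lift_pr1 C i p q) = ihom C (Dom C i) (Dom C p)"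
    "lift_pr2 C i p q \<in> Arr C" "Dom C (lift_pr2 C i p q) = lift_dom C i p q"
    "Cod C (lift_pr2 C i p q) = ihom C (Cod C i) (Dom C q)"
  using assms by (simp_all add: lift_dom_def lift_pr1_def lift_pr2_def)

lemma lift_dom_square:
  assumes "exponentiable C (Dom C i)" "exponentiable C (Cod C i)" "i \<in> Arr C"
    and "p \<in> Arr C" "q \<in> Arr C" "Cod C q = Cod C p"
  shows "ihom_post C (Dom C i) p \<cdot> lift_pr1 C i p q =
    ihom_pre C i (Cod C p) \<cdot> (ihom_post C (Cod C i) q \<cdot> lift_pr2 C i p q)"
proof -
  have "lift_leg1 C i p \<cdot> lift_pr1 C i p q = lift_leg2 C i q \<cdot> lift_pr2 C i p q"
    unfolding lift_pr1_def lift_pr2_def by (rule pb_square) (use assms in simp_all)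
  then show ?thesis using assms by (simp add: lift_leg1_def lift_leg2_def)
qed

text \<open>
  The universal lifting problem, posed at the representing object itself, has the transposes of
  the two projections as its data. That the value of the lifting structure there is a solution
  says, after transposition, that the induced map lies over $[U,E] \times_{[U,B]} [V,B]$.
\<close>

lemma lift_map_props:
  assumes U: "exponentiable C (Dom C i)" and V: "exponentiable C (Cod C i)"
    and i: "i \<in> Arr C" and p: "p \<in> Arr C" and q: "q \<in> Arr C" "Cod C q = Cod C p"
    and F: "lifting_structure C i p q F"
  shows "lift_map C i p q F \<in> hom C (lift_dom C i p q) (ihom C (Cod C i) (Dom C p))"
    "ihom_pre C i (Dom C p) \<cdot> lift_map C i p q F = lift_pr1 C i p q"
    "ihom_post C (Cod C i) p \<cdot> lift_map C i p q F = ihom_post C (Cod C i) q \<cdot> lift_pr2 C i p q"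
proof -
  let ?U = "Dom C i" and ?V = "Cod C i" and ?E = "Dom C p" and ?B' = "Dom C q"
  let ?D = "lift_dom C i p q" and ?r1 = "lift_pr1 C i p q" and ?r2 = "lift_pr2 C i p q"
  let ?u = "ev C ?U ?E \<cdot> prd_map C ?r1 (Id C ?U)"
  let ?v = "ev C ?V ?B' \<cdot> prd_map C ?r2 (Id C ?V)"
  let ?f = "F ?D ?u ?v"
  note types = lift_dom_types[OF U V i p q]
  have UV: "?U \<in> Obj C" "?V \<in> Obj C" using U V by simp_all
  have u_eq: "?u = ev C ?U ?E \<cdot> pair C (?r1 \<cdot> prd1 C ?D ?U) (prd2 C ?D ?U)"
    and v_eq: "?v = ev C ?V ?B' \<cdot> pair C (?r2 \<cdot> prd1 C ?D ?V) (prd2 C ?D ?V)"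
    using types UV by (simp_all add: prd_map_def)
  have i_eq: "prd_map C (Id C ?D) i = pair C (prd1 C ?D ?U) (i \<cdot> prd2 C ?D ?U)"
    using types UV i by (simp add: prd_map_def)
  have u: "?u \<in> hom C (prd C ?D ?U) ?E" and v: "?v \<in> hom C (prd C ?D ?V) ?B'"
    unfolding u_eq v_eq using types UV U V p q by simp_all
  have "p \<cdot> ?u = ev C ?U (Cod C p) \<cdot> pair C ((ihom_post C ?U p \<cdot> ?r1) \<cdot> prd1 C ?D ?U) (prd2 C ?D ?U)"
    unfolding u_eq using types UV U p by simp
  also have "\<dots> = q \<cdot> ?v \<cdot> prd_map C (Id C ?D) i"
    unfolding lift_dom_square[OF U V i p q] v_eq i_eq using types UV U V i p q by simp
  finally have sq: "p \<cdot> ?u = q \<cdot> ?v \<cdot> prd_map C (Id C ?D) i" .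
  have f: "?f \<in> hom C (prd C ?D ?V) ?E" "?f \<cdot> prd_map C (Id C ?D) i = ?u" "p \<cdot> ?f = q \<cdot> ?v"
    using F types(1) u v sq unfolding lifting_structure_def Let_def by blast+
  have L: "lift_map C i p q F = transpose C ?D ?V ?E ?f"
    by (simp add: lift_map_def Let_def)
  show *: "lift_map C i p q F \<in> hom C ?D (ihom C ?V ?E)"
    unfolding L using f(1) V types by simp
  have evL: "ev C ?V ?E \<cdot> pair C (lift_map C i p q F \<cdot> x) a = ?f \<cdot> pair C x a"
    if "x \<in> Arr C" "Cod C x = ?D" "a \<in> Arr C" "Cod C a = ?V" "Dom C x = Dom C a" for x a
    unfolding L using f(1) V types that by simp
  show "ihom_pre C i ?E \<cdot> lift_map C i p q F = ?r1"
  proof (rule ihom_ext[OF U, of ?E _ ?D])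
    show "ev C ?U ?E \<cdot> pair C ((ihom_pre C i ?E \<cdot> lift_map C i p q F) \<cdot> prd1 C ?D ?U) (prd2 C ?D ?U) =
        ev C ?U ?E \<cdot> pair C (?r1 \<cdot> prd1 C ?D ?U) (prd2 C ?D ?U)"
      using f(2) evL[of "prd1 C ?D ?U" "i \<cdot> prd2 C ?D ?U"] * U V UV i p types
      unfolding i_eq u_eq by simp
  qed (use * U V i p types in simp_all)
  show "ihom_post C ?V p \<cdot> lift_map C i p q F = ihom_post C ?V q \<cdot> ?r2"
  proof (rule ihom_ext[OF V, of "Cod C p" _ ?D])
    have "ev C ?V (Cod C p) \<cdot> pair C ((ihom_post C ?V p \<cdot> lift_map C i p q F) \<cdot> prd1 C ?D ?V) (prd2 C ?D ?V)
        = p \<cdot> ?f"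
      using evL[of "prd1 C ?D ?V" "prd2 C ?D ?V"] * f(1) V UV p types by simp
    also have "\<dots> = q \<cdot> ?v" by (rule f(3))
    also have "\<dots> = ev C ?V (Cod C p) \<cdot> pair C ((ihom_post C ?V q \<cdot> ?r2) \<cdot> prd1 C ?D ?V) (prd2 C ?D ?V)"
      unfolding v_eq using V UV q types by simp
    finally show "ev C ?V (Cod C p) \<cdot>
        pair C ((ihom_post C ?V p \<cdot> lift_map C i p q F) \<cdot> prd1 C ?D ?V) (prd2 C ?D ?V) =
        ev C ?V (Cod C p) \<cdot> pair C ((ihom_post C ?V q \<cdot> ?r2) \<cdot> prd1 C ?D ?V) (prd2 C ?D ?V)" .
  qed (use * V p q types in simp_all)
qed

text \<open>
  The induced map of lifting problems exists because both ways around to $[U,B_2]$ factor through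
  $[U,b]$ and the square that defines the lifting problems on the left.
\<close>

lemma lift_dom_map_props:
  assumes U: "exponentiable C (Dom C i)" and V: "exponentiable C (Cod C i)" and i: "i \<in> Arr C"
    and p1: "p1 \<in> hom C E1 B1" and q1: "q1 \<in> hom C B1' B1"
    and p2: "p2 \<in> hom C E2 B2" and q2: "q2 \<in> hom C B2' B2"
    and e: "e \<in> hom C E1 E2" and b: "b \<in> hom C B1 B2" and b': "b' \<in> hom C B1' B2'"
    and sq_p: "p2 \<cdot> e = b \<cdot> p1" and sq_q: "q2 \<cdot> b' = b \<cdot> q1"
  shows "lift_dom_map C i p1 q1 p2 q2 e b' \<in> hom C (lift_dom C i p1 q1) (lift_dom C i p2 q2)"
    "lift_pr1 C i p2 q2 \<cdot> lift_dom_map C i p1 q1 p2 q2 e b' =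
      ihom_post C (Dom C i) e \<cdot> lift_pr1 C i p1 q1"
    "lift_pr2 C i p2 q2 \<cdot> lift_dom_map C i p1 q1 p2 q2 e b' =
      ihom_post C (Cod C i) b' \<cdot> lift_pr2 C i p1 q1"
proof -
  let ?U = "Dom C i" and ?V = "Cod C i"
  let ?g = "lift_dom_map C i p1 q1 p2 q2 e b'"
  let ?x = "ihom_post C ?U e \<cdot> lift_pr1 C i p1 q1" and ?y = "ihom_post C ?V b' \<cdot> lift_pr2 C i p1 q1"
  have "B1 \<in> Obj C" "B2 \<in> Obj C" using p1 p2 by auto
  note types = U V i p1 q1 p2 q2 e b b' this
  have post_p: "ihom_post C ?U p2 \<cdot> ihom_post C ?U e = ihom_post C ?U b \<cdot> ihom_post C ?U p1"
    using ihom_post_Comp[of ?U e p2] ihom_post_Comp[of ?U p1 b] types sq_p by simp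
  have post_q: "ihom_post C ?V q2 \<cdot> ihom_post C ?V b' = ihom_post C ?V b \<cdot> ihom_post C ?V q1"
    using ihom_post_Comp[of ?V b' q2] ihom_post_Comp[of ?V q1 b] types sq_q by simp
  have pre_b: "ihom_pre C i B2 \<cdot> ihom_post C ?V b = ihom_post C ?U b \<cdot> ihom_pre C i B1"
    using ihom_pre_post[of i b] types by simp
  have "ihom_post C ?U p2 \<cdot> ?x = ihom_post C ?U b \<cdot> (ihom_post C ?U p1 \<cdot> lift_pr1 C i p1 q1)"
    by (rule square_Comp[OF post_p]) (use types in simp_all)
  also have "\<dots> = ihom_post C ?U b \<cdot>
      (ihom_pre C i B1 \<cdot> (ihom_post C ?V q1 \<cdot> lift_pr2 C i p1 q1))"
    using lift_dom_square[of i p1 q1] types by simp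
  also have "\<dots> = ihom_pre C i B2 \<cdot> (ihom_post C ?V b \<cdot> (ihom_post C ?V q1 \<cdot> lift_pr2 C i p1 q1))"
    by (rule square_Comp[OF pre_b, symmetric]) (use types in simp_all)
  also have "ihom_post C ?V b \<cdot> (ihom_post C ?V q1 \<cdot> lift_pr2 C i p1 q1) = ihom_post C ?V q2 \<cdot> ?y"
    by (rule square_Comp[OF post_q, symmetric]) (use types in simp_all)
  finally have "lift_leg1 C i p2 \<cdot> ?x = lift_leg2 C i q2 \<cdot> ?y"
    using types by (simp add: lift_leg1_def lift_leg2_def)
  then have "?g \<in> Arr C" "Dom C ?g = lift_dom C i p1 q1" "Cod C ?g = lift_dom C i p2 q2"
    "lift_pr1 C i p2 q2 \<cdot> ?g = ?x" "lift_pr2 C i p2 q2 \<cdot> ?g = ?y"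
    unfolding lift_dom_map_def lift_pr1_def[of C i p2 q2] lift_pr2_def[of C i p2 q2]
      lift_dom_def[of C i p2 q2]
    by (subst pb_pair_props; use types in simp)+
  then show "?g \<in> hom C (lift_dom C i p1 q1) (lift_dom C i p2 q2)"
    "lift_pr1 C i p2 q2 \<cdot> ?g = ?x" "lift_pr2 C i p2 q2 \<cdot> ?g = ?y"
    by simp_all
qed

end

lemma lcc_categoryI: "locally_cartesian_closed C \<Longrightarrow> lcc_category C"
  unfolding locally_cartesian_closed_def lcc_category_def finitely_complete_category_def
    finitely_complete_category_axioms_def lcc_category_axioms_def
  by blast

section \<open>Existence of a structured witness\<close>

theorem theorem6p5:
  fixes C :: "('o, 'm) cat" (structure)
    and Weq Cof Fib :: "'m set"
    and I U V E1 E2 B1 B2 B1' B2' :: 'o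
    and i j s p1 p2 q1 q2 e b b' :: 'm
    and F1 F2 :: "'o \<Rightarrow> 'm \<Rightarrow> 'm \<Rightarrow> 'm"
  assumes lccc: "locally_cartesian_closed C"
    and model: "model_structure C Weq Cof Fib"
    and cylinder: "good_cylinder C Weq Cof (one C) I j s"
    and cof_products: "\<And>c D. c \<in> Cof \<Longrightarrow> D \<in> Obj C \<Longrightarrow> prd_map C (Id C D) c \<in> Cof"
    and pullback_power_left: "\<And>c f. c \<in> Cof \<inter> Weq \<Longrightarrow> f \<in> Fib \<Longrightarrow>
      pullback_power C c f \<in> Fib \<inter> Weq"
    and pullback_power_right: "\<And>c f. c \<in> Cof \<Longrightarrow> f \<in> Fib \<inter> Weq \<Longrightarrow>
      pullback_power C c f \<in> Fib \<inter> Weq"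
    and U_exp: "exponentiable C U" and V_exp: "exponentiable C V"
    and i: "i \<in> hom C U V"
    and p1: "p1 \<in> hom C E1 B1" and q1: "q1 \<in> hom C B1' B1"
    and p2: "p2 \<in> hom C E2 B2" and q2: "q2 \<in> hom C B2' B2"
    and e: "e \<in> hom C E1 E2" and b: "b \<in> hom C B1 B2" and b': "b' \<in> hom C B1' B2'"
    and square_p: "p2 \<cdot> e = b \<cdot> p1" and square_q: "q2 \<cdot> b' = b \<cdot> q1"
    and F1: "lifting_structure C i p1 q1 F1"
    and F2: "lifting_structure C i p2 q2 F2"
    and pair_cases: "(i \<in> Cof \<inter> Weq \<and> p2 \<in> Fib) \<or> (i \<in> Cof \<and> p2 \<in> Fib \<inter> Weq)"
  shows "\<exists>H. structured_witness C i p1 q1 p2 q2 e b' F1 F2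
    (path_object C I p2) (path_boundary C I j p2) H"
proof -
  interpret lcc_category C by (rule lcc_categoryI[OF lccc])
  have types: "exponentiable C (Dom C i)" "exponentiable C (Cod C i)" "i \<in> Arr C"
    using U_exp V_exp i by auto
  have V: "Cod C i = V" using i by simp
  have arrs: "p1 \<in> Arr C" "q1 \<in> Arr C" "Cod C q1 = Cod C p1" "p2 \<in> Arr C" "q2 \<in> Arr C"
    "Cod C q2 = Cod C p2" "Dom C p1 = E1" "Dom C p2 = E2" "Cod C p2 = B2"
    "E1 \<in> Obj C" "E2 \<in> Obj C" "B1 \<in> Obj C" "B2 \<in> Obj C"
    using p1 q1 p2 q2 by auto
  note L1 = lift_map_props[OF types arrs(1-3) F1, unfolded V arrs]
  note L2 = lift_map_props[OF types arrs(4-6) F2, unfolded V arrs]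
  note G = lift_dom_map_props[OF types p1 q1 p2 q2 e b b' square_p square_q, unfolded V]
  let ?D = "lift_dom C i p1 q1" and ?k = "pullback_power C i p2"
  let ?L1 = "lift_map C i p1 q1 F1" and ?L2 = "lift_map C i p2 q2 F2"
  let ?G = "lift_dom_map C i p1 q1 p2 q2 e b'"
  let ?m = "ihom_post C V e \<cdot> ?L1" and ?n = "?L2 \<cdot> ?G"
  have D: "?D \<in> Obj C" using types arrs by simp
  have m: "?m \<in> hom C ?D (ihom C V E2)" and n: "?n \<in> hom C ?D (ihom C V E2)"
    using L1(1) L2(1) G(1) e V_exp by simp_all
  \<comment> \<open>Both maps solve the transported problem: they have the same restriction to \<open>U\<close> \<close>
  have pre: "ihom_pre C i E2 \<cdot> ?m = ihom_pre C i E2 \<cdot> ?n"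
  proof -
    have "ihom_pre C i E2 \<cdot> ihom_post C V e = ihom_post C U e \<cdot> ihom_pre C i E1"
      using ihom_pre_post[of i e] types i e arrs by simp
    then have "ihom_pre C i E2 \<cdot> ?m = ihom_post C U e \<cdot> (ihom_pre C i E1 \<cdot> ?L1)"
      by (rule square_Comp) (use L1(1) types i e U_exp V_exp arrs in auto)
    also have "\<dots> = lift_pr1 C i p2 q2 \<cdot> ?G" using L1(2) G(2) i arrs by simp
    also have "\<dots> = (ihom_pre C i E2 \<cdot> ?L2) \<cdot> ?G" using L2(2) by simp
    also have "\<dots> = ihom_pre C i E2 \<cdot> ?n"
      using L2(1) G(1) types i p2 arrs by (intro Comp_assoc_right) auto
    finally show ?thesis .
  qed
  \<comment> \<open>and lie over the same map to \<open>[V,B\<^sub>2]\<close>.\<close>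
  have post: "ihom_post C V p2 \<cdot> ?m = ihom_post C V p2 \<cdot> ?n"
  proof -
    have 1: "ihom_post C V p2 \<cdot> ihom_post C V e = ihom_post C V b \<cdot> ihom_post C V p1"
      using ihom_post_Comp[of V e p2] ihom_post_Comp[of V p1 b] V_exp p1 p2 e b square_p by simp
    have 2: "ihom_post C V q2 \<cdot> ihom_post C V b' = ihom_post C V b \<cdot> ihom_post C V q1"
      using ihom_post_Comp[of V b' q2] ihom_post_Comp[of V q1 b] V_exp q1 q2 b b' square_q by simp
    have "ihom_post C V p2 \<cdot> ?m = ihom_post C V b \<cdot> (ihom_post C V p1 \<cdot> ?L1)"
      by (rule square_Comp[OF 1]) (use L1(1) V_exp p1 p2 e b in auto)
    also have "\<dots> = ihom_post C V b \<cdot> (ihom_post C V q1 \<cdot> lift_pr2 C i p1 q1)"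
      using L1(3) by simp
    also have "\<dots> = ihom_post C V q2 \<cdot> (ihom_post C V b' \<cdot> lift_pr2 C i p1 q1)"
      by (rule square_Comp[OF 2, symmetric]) (use V_exp types arrs q1 q2 b b' V in auto)
    also have "\<dots> = ihom_post C V q2 \<cdot> (lift_pr2 C i p2 q2 \<cdot> ?G)" using G(3) by simp
    also have "\<dots> = ihom_post C V p2 \<cdot> ?n"
      by (rule square_Comp[OF L2(3), symmetric])
        (use L2(1) G(1) V_exp types arrs q2 V in auto)
    finally show ?thesis .
  qed
  note k = pullback_power_props[OF types arrs(4), unfolded V arrs]
  have kmn: "?k \<cdot> ?m = ?k \<cdot> ?n"
    by (rule pullback_power_Comp_eqI[OF types arrs(4)]) (use m n pre post V arrs in simp_all)

  have cop: "\<exists>S. is_coproduct C (one C) (one C) S"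
    and j: "j \<in> hom C (coprd C (one C) (one C)) I" "j \<in> Cof"
    using cylinder by (auto simp: good_cylinder_def)
  have I: "I \<in> Obj C" using j by auto
  have "?k \<in> Fib \<inter> Weq"
    using pair_cases pullback_power_left pullback_power_right by blast
  moreover have "prd_map C (Id C ?D) j \<in> Cof" by (rule cof_products[OF j(2) D])
  moreover have "weak_factorisation_system C Cof (Fib \<inter> Weq)"
    using model by (simp add: model_structure_def)
  ultimately have lifts: "lifts_against C (prd_map C (Id C ?D) j) ?k"
    unfolding weak_factorisation_system_def by blast
  let ?i1 = "inj1 C (one C) (one C)" and ?i2 = "inj2 C (one C) (one C)"
  have inj: "?i1 \<in> hom C (one C) (coprd C (one C) (one C))"
    "?i2 \<in> hom C (one C) (coprd C (one C) (one C))"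
    using coprd_is_coproduct[OF cop] by (auto simp: is_coproduct_def)
  obtain h where h: "h \<in> hom C (prd C ?D I) (ihom C V E2)"
    and kh: "?k \<cdot> h = ?k \<cdot> (?m \<cdot> prd1 C ?D I)"
    and ends: "h \<cdot> pair C (Id C ?D) (j \<cdot> (?i1 \<cdot> bang C ?D)) = ?m"
      "h \<cdot> pair C (Id C ?D) (j \<cdot> (?i2 \<cdot> bang C ?D)) = ?n"
    using fibrewise_homotopy[OF cop j(1) k(1) _ _ kmn lifts] m n k(2) by metis
  \<comment> \<open>Transposition needs the homotopy to be constant over \<open>[V,B\<^sub>2]\<close> only, which is the second
     component of being constant over the codomain of the pullback-power.\<close>
  let ?r = "pb2 C (ihom_post C (Dom C i) p2) (ihom_pre C i B2)"
  have r: "?r \<in> Arr C" "Dom C ?r = Cod C ?k"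
    using types arrs k(5) by simp_all
  have "ihom_post C V p2 \<cdot> h = ?r \<cdot> (?k \<cdot> h)"
    using k r h by (metis Comp_assoc_right hom_iff)
  also have "\<dots> = ihom_post C V p2 \<cdot> (?m \<cdot> prd1 C ?D I)"
  proof -
    have "?m \<cdot> prd1 C ?D I \<in> hom C (prd C ?D I) (ihom C V E2)"
      using Comp_hom[of "prd1 C ?D I" _ _ ?m] m D I by simp
    then show ?thesis unfolding kh using k r by (metis Comp_assoc_right hom_iff)
  qed
  also have "\<dots> = (ihom_post C V p2 \<cdot> ?m) \<cdot> prd1 C ?D I"
    by (rule Comp_assoc_right[symmetric]) (use m D I V_exp arrs in \<open>auto simp del: Comp_types\<close>)
  finally have const: "ihom_post C V p2 \<cdot> h = (ihom_post C V p2 \<cdot> ?m) \<cdot> prd1 C ?D I" .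
  have base: "ihom_post C V p2 \<cdot> ?m \<in> hom C ?D (ihom C V (Cod C p2))"
    by (rule Comp_hom[OF m]) (use V_exp arrs in simp)
  obtain H where H: "H \<in> hom C ?D (ihom C V (path_object C I p2))"
    and Hev: "\<And>t. t \<in> hom C (one C) I \<Longrightarrow>
      ihom_post C V (path_ev C I p2 t) \<cdot> H = h \<cdot> pair C (Id C ?D) (t \<cdot> bang C ?D)"
    using ihom_path_transpose[OF V_exp arrs(4) I _ D base const] h arrs(8) by metis

  let ?t1 = "j \<cdot> ?i1" and ?t2 = "j \<cdot> ?i2" and ?O = "path_object C I p2"
  have t: "?t1 \<in> hom C (one C) I" "?t2 \<in> hom C (one C) I" using j inj by simp_all
  have Hm: "ihom_post C V (path_ev C I p2 ?t1) \<cdot> H = ?m"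
    and Hn: "ihom_post C V (path_ev C I p2 ?t2) \<cdot> H = ?n"
    using Hev[OF t(1)] Hev[OF t(2)] ends j inj D by simp_all
  let ?bd = "path_boundary C I j p2"
  have e12: "path_ev C I p2 ?t1 \<in> hom C ?O E2" "path_ev C I p2 ?t2 \<in> hom C ?O E2"
    "p2 \<cdot> path_ev C I p2 ?t1 = p2 \<cdot> path_ev C I p2 ?t2"
    using path_ev_types[OF arrs(4) I] t arrs by simp_all
  note boundary = pb_pair_props[OF arrs(4,4) refl e12(3), folded path_boundary_def]
  have bd: "?bd \<in> hom C ?O (pb C p2 p2)" "pb1 C p2 p2 \<cdot> ?bd = path_ev C I p2 ?t1"
    "pb2 C p2 p2 \<cdot> ?bd = path_ev C I p2 ?t2"
    using boundary e12 arrs by auto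
  let ?P = "ihom_post C V p2"
  have pb: "pb1 C p2 p2 \<in> hom C (pb C p2 p2) E2" "pb2 C p2 p2 \<in> hom C (pb C p2 p2) E2"
    using arrs by simp_all
  have bdH: "ihom_post C V ?bd \<cdot> H \<in> hom C ?D (ihom C V (pb C p2 p2))"
    using bd(1) H V_exp by simp
  \<comment> \<open>The boundary condition on the witness is checked at each of the two endpoints.\<close>
  have eqs: "ihom_post C V (pb1 C p2 p2) \<cdot> (ihom_post C V ?bd \<cdot> H) = ?m"
    "ihom_post C V (pb2 C p2 p2) \<cdot> (ihom_post C V ?bd \<cdot> H) = ?n"
  proof -
    have "ihom_post C V (pb1 C p2 p2) \<cdot> ihom_post C V ?bd = ihom_post C V (path_ev C I p2 ?t1)"
      using ihom_post_Comp[OF V_exp, of ?bd "pb1 C p2 p2"] bd pb by simp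
    then show "ihom_post C V (pb1 C p2 p2) \<cdot> (ihom_post C V ?bd \<cdot> H) = ?m"
      using Comp_assoc_right[of H "ihom_post C V ?bd" "ihom_post C V (pb1 C p2 p2)"]
        Hm H bd(1) pb V_exp by (metis hom_iff ihom_post_types)
    have "ihom_post C V (pb2 C p2 p2) \<cdot> ihom_post C V ?bd = ihom_post C V (path_ev C I p2 ?t2)"
      using ihom_post_Comp[OF V_exp, of ?bd "pb2 C p2 p2"] bd pb by simp
    then show "ihom_post C V (pb2 C p2 p2) \<cdot> (ihom_post C V ?bd \<cdot> H) = ?n"
      using Comp_assoc_right[of H "ihom_post C V ?bd" "ihom_post C V (pb2 C p2 p2)"]
        Hn H bd(1) pb V_exp by (metis hom_iff ihom_post_types)
  qed
  have "?P \<cdot> ihom_post C V (pb1 C p2 p2) = ?P \<cdot> ihom_post C V (pb2 C p2 p2)"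
    using ihom_post_Comp[OF V_exp, of "pb1 C p2 p2" p2] ihom_post_Comp[OF V_exp, of "pb2 C p2 p2" p2]
      pb_square[OF arrs(4,4) refl] pb arrs by simp
  note pair_Comp = pb_pair_Comp[OF _ _ refl this]
  have "pb_pair C ?P ?P (ihom_post C V (pb1 C p2 p2)) (ihom_post C V (pb2 C p2 p2)) \<cdot>
      ihom_post C V ?bd \<cdot> H = pb_pair C ?P ?P ?m ?n"
    using pair_Comp[of "ihom_post C V ?bd \<cdot> H"] bdH eqs pb V_exp arrs by simp
  then have "structured_witness C i p1 q1 p2 q2 e b' F1 F2 ?O ?bd H"
    using bd(1) H V unfolding structured_witness_def Let_def by simp
  then show ?thesis ..
qed

end
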